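(* Let $\mathbb{T}$ be a monad on $\mathsf{Pos}$ which preserves coinserters of congruences. Then $\mathsf{Pos}^{\mathbb{T}}\simeq(\mathsf{Kl}(\mathbb{T})_{d})_{\mathrm{ex}}$.
   Context: Conventions. $\mathsf{Pos}$ is the cartesian closed category of posets and monotone maps, regarded as enriched over itself (homs ordered pointwise). "Category" means $\mathsf{Pos}$-enriched category (hom-sets are posets and composition is monotone in both variables); "functor" and "monad" are $\mathsf{Pos}$-enriched (i.e. the functors are locally monotone); $\simeq$ denotes equivalence of $\mathsf{Pos}$-enriched categories. Monads. $\mathsf{Pos}^{\mathbb{T}}$ is the ($\mathsf{Pos}$-enriched) category of Eilenberg–Moore algebras of $\mathbb{T}=(T,\eta,\mu)$, with homs ordered pointwise. $\mathsf{Kl}(\mathbb{T})_d$ is the full subcategory of the Kleisli category $\mathsf{Kl}(\mathbb{T})$ on the algebras which are free on a discrete poset, i.e. on the $(TX,\mu_X)$ with $X$ a discrete poset (so homs are $\mathsf{Pos}(X,TY)$). A congruence on a poset $X$ is a subposet $R\subseteq X\times X$ (with projections $r_0,r_1\colon R\to X$) which is a preorder containing the order $\leq$ of $X$. The coinserter of an ordered pair $f,g\colon X\to Y$ is the universal $q\colon Y\to Q$ with $qf\leq qg$ (any $h$ with $hf\leq hg$ factors through $q$, and $uq\leq vq$ implies $u\leq v$). $\mathbb{T}$ preserves coinserters of congruences if whenever $q$ is the coinserter of a congruence $(r_0,r_1)$ in $\mathsf{Pos}$, $Tq$ is the coinserter of $(Tr_0,Tr_1)$. Weakly lex categories. For a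 diagram $D\colon\mathcal{D}\to\mathcal{C}$ and a weight $W\colon\mathcal{D}\to\mathsf{Pos}$, a weak $W$-weighted limit is an object $\{W,D\}_w$ with a natural transformation $W\to\mathcal{C}(\{W,D\}_w,D-)$ such that for all $X$ the induced map $\mathcal{C}(X,\{W,D\}_w)\to[\mathcal{D},\mathsf{Pos}](W,\mathcal{C}(X,D-))$ is surjective. $W$ is finite if $\mathcal{D}$ has finitely many isomorphism classes of objects and all $\mathcal{D}(d,d')$ and $Wd$ are finite. $\mathcal{C}$ is weakly lex if all weak limits with finite weights exist. Under the hypothesis on $\mathbb{T}$, the category $\mathsf{Kl}(\mathbb{T})_d$ is weakly lex. The category $\mathcal{C}_{\mathrm{ex}}$ for $\mathcal{C}$ weakly lex. A pseudocongruence in $\mathcal{C}$ is a parallel pair $r_0,r_1\colon R\to X$ such that: (1) for every $a_0\leq a_1\colon A\to X$ there is $u\colon A\to R$ with $r_0u=a_0$, $r_1u=a_1$; (2) for a weak pullback $d_0,d_1\colon R*R\to R$ with $r_1d_0=r_0d_1$ there is $\tau\colon R*R\to R$ with $r_0\tau=r_0d_0$, $r_1\tau=r_1d_1$. Objects of $\mathcal{C}_{\mathrm{ex}}$ are the pseudocongruences, written $(X,R)$. Given $(X,R)$ and $(Y,S)$, consider $f\colon X\to Y$ in $\mathcal{C}$ for which there is $\bar f\colon R\to S$ with $s_0\bar f=fr_0$, $s_1\bar f=fr_1$; put $f\preccurlyeq g$ iff there is $\Sigma\colon X\to S$ with $s_0\Sigma=f$, $s_1\Sigma=g$ (a preorder).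 Morphisms $[f]\colon(X,R)\to(Y,S)$ are the classes of such $f$ under the induced equivalence relation, ordered by $[f]\leq[g]$ iff $f\preccurlyeq g$, with composition induced from $\mathcal{C}$. *)

theory Defs
  imports "HOL-Library.FuncSet" "HOL-Library.Equipollence"
begin

section \<open>Pos-enriched categories\<close>

text \<open>
  A poset is encoded by its order relation \<open>r\<close> with \<open>Partial_order r\<close>; its carrier is \<open>Field r\<close>
  (no information is lost, since the order is reflexive on the carrier). In particular the single
  component \<open>hom\<close> below gives both the hom-sets and their orders. Composition and identities take
  the objects involved as arguments, so hom-sets of different pairs of objects need not be disjoint.
  \<open>cmp C a b c g f\<close> is the composite of \<open>f : a \<rightarrow> b\<close> and \<open>g : b \<rightarrow> c\<close>.
\<close>

record ('o, 'm) pcat =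
  ob :: "'o set"
  hom :: "'o \<Rightarrow> 'o \<Rightarrow> 'm rel"
  idn :: "'o \<Rightarrow> 'm"
  cmp :: "'o \<Rightarrow> 'o \<Rightarrow> 'o \<Rightarrow> 'm \<Rightarrow> 'm \<Rightarrow> 'm"

definition arr :: "('o, 'm) pcat \<Rightarrow> 'o \<Rightarrow> 'o \<Rightarrow> 'm set" where
  "arr C a b = Field (hom C a b)"

locale pos_category =
  fixes C :: "('o, 'm) pcat"
  assumes hom_poset: "\<lbrakk>a \<in> ob C; b \<in> ob C\<rbrakk> \<Longrightarrow> Partial_order (hom C a b)"
    and idn_arr: "a \<in> ob C \<Longrightarrow> idn C a \<in> arr C a a"
    and cmp_mono: "\<lbrakk>a \<in> ob C; b \<in> ob C; c \<in> ob C; (f, f') \<in> hom C a b; (g, g') \<in> hom C b c\<rbrakk>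
      \<Longrightarrow> (cmp C a b c g f, cmp C a b c g' f') \<in> hom C a c"
    and cmp_idn_right: "\<lbrakk>a \<in> ob C; b \<in> ob C; f \<in> arr C a b\<rbrakk> \<Longrightarrow> cmp C a a b f (idn C a) = f"
    and cmp_idn_left: "\<lbrakk>a \<in> ob C; b \<in> ob C; f \<in> arr C a b\<rbrakk> \<Longrightarrow> cmp C a b b (idn C b) f = f"
    and cmp_assoc: "\<lbrakk>a \<in> ob C; b \<in> ob C; c \<in> ob C; d \<in> ob C;
        f \<in> arr C a b; g \<in> arr C b c; h \<in> arr C c d\<rbrakk>
      \<Longrightarrow> cmp C a b d (cmp C b c d h g) f = cmp C a c d h (cmp C a b c g f)"

definition full_sub :: "('o, 'm) pcat \<Rightarrow> 'o set \<Rightarrow> ('o, 'm) pcat" where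
  "full_sub C A = C\<lparr>ob := ob C \<inter> A\<rparr>"

subsection \<open>Functors, natural transformations, equivalence\<close>

record ('o, 'm, 'p, 'n) pfun =
  fob :: "'o \<Rightarrow> 'p"
  fmap :: "'o \<Rightarrow> 'o \<Rightarrow> 'm \<Rightarrow> 'n"

locale pos_functor = C: pos_category C + D: pos_category D
  for C :: "('o, 'm) pcat" and D :: "('p, 'n) pcat" +
  fixes F :: "('o, 'm, 'p, 'n) pfun"
  assumes fob_ob: "a \<in> ob C \<Longrightarrow> fob F a \<in> ob D"
    and fmap_mono: "\<lbrakk>a \<in> ob C; b \<in> ob C; (f, f') \<in> hom C a b\<rbrakk>
      \<Longrightarrow> (fmap F a b f, fmap F a b f') \<in> hom D (fob F a) (fob F b)"
    and fmap_idn: "a \<in> ob C \<Longrightarrow> fmap F a a (idn C a) = idn D (fob F a)"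
    and fmap_cmp: "\<lbrakk>a \<in> ob C; b \<in> ob C; c \<in> ob C; f \<in> arr C a b; g \<in> arr C b c\<rbrakk>
      \<Longrightarrow> fmap F a c (cmp C a b c g f)
          = cmp D (fob F a) (fob F b) (fob F c) (fmap F b c g) (fmap F a b f)"

definition id_fun :: "('o, 'm, 'o, 'm) pfun" where
  "id_fun = \<lparr>fob = \<lambda>a. a, fmap = \<lambda>a b f. f\<rparr>"

definition comp_fun ::
    "('p, 'n, 'q, 'k) pfun \<Rightarrow> ('o, 'm, 'p, 'n) pfun \<Rightarrow> ('o, 'm, 'q, 'k) pfun" where
  "comp_fun G F = \<lparr>fob = \<lambda>a. fob G (fob F a),
     fmap = \<lambda>a b f. fmap G (fob F a) (fob F b) (fmap F a b f)\<rparr>"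

text \<open>Over Pos, enriched naturality is ordinary naturality of the underlying functors.\<close>

definition nat_trans :: "('o, 'm) pcat \<Rightarrow> ('p, 'n) pcat \<Rightarrow> ('o, 'm, 'p, 'n) pfun \<Rightarrow>
    ('o, 'm, 'p, 'n) pfun \<Rightarrow> ('o \<Rightarrow> 'n) \<Rightarrow> bool" where
  "nat_trans C D F G \<alpha> \<longleftrightarrow>
     (\<forall>a\<in>ob C. \<alpha> a \<in> arr D (fob F a) (fob G a)) \<and>
     (\<forall>a\<in>ob C. \<forall>b\<in>ob C. \<forall>f\<in>arr C a b.
        cmp D (fob F a) (fob F b) (fob G b) (\<alpha> b) (fmap F a b f)
        = cmp D (fob F a) (fob G a) (fob G b) (fmap G a b f) (\<alpha> a))"

definition is_iso :: "('o, 'm) pcat \<Rightarrow> 'o \<Rightarrow> 'o \<Rightarrow> 'm \<Rightarrow> bool" where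
  "is_iso C a b f \<longleftrightarrow> f \<in> arr C a b \<and>
     (\<exists>g\<in>arr C b a. cmp C a b a g f = idn C a \<and> cmp C b a b f g = idn C b)"

definition nat_iso :: "('o, 'm) pcat \<Rightarrow> ('p, 'n) pcat \<Rightarrow> ('o, 'm, 'p, 'n) pfun \<Rightarrow>
    ('o, 'm, 'p, 'n) pfun \<Rightarrow> ('o \<Rightarrow> 'n) \<Rightarrow> bool" where
  "nat_iso C D F G \<alpha> \<longleftrightarrow> nat_trans C D F G \<alpha> \<and>
     (\<forall>a\<in>ob C. is_iso D (fob F a) (fob G a) (\<alpha> a))"

text \<open>The requirements on \<open>F\<close> and \<open>G\<close> include that \<open>C\<close> and \<open>D\<close> are Pos-enriched categories.\<close>

definition pos_equivalent :: "('o, 'm) pcat \<Rightarrow> ('p, 'n) pcat \<Rightarrow> bool" where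
  "pos_equivalent C D \<longleftrightarrow> (\<exists>F G \<alpha> \<beta>. pos_functor C D F \<and> pos_functor D C G \<and>
     nat_iso C C id_fun (comp_fun G F) \<alpha> \<and> nat_iso D D (comp_fun F G) id_fun \<beta>)"

subsection \<open>Coinserters and weak pullbacks\<close>

definition is_coinserter ::
    "('o, 'm) pcat \<Rightarrow> 'o \<Rightarrow> 'o \<Rightarrow> 'm \<Rightarrow> 'm \<Rightarrow> 'o \<Rightarrow> 'm \<Rightarrow> bool" where
  "is_coinserter C X Y f g Q q \<longleftrightarrow>
     q \<in> arr C Y Q \<and> (cmp C X Y Q q f, cmp C X Y Q q g) \<in> hom C X Q \<and>
     (\<forall>Z\<in>ob C.
        (\<forall>h\<in>arr C Y Z. (cmp C X Y Z h f, cmp C X Y Z h g) \<in> hom C X Z \<longrightarrow>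
           (\<exists>u\<in>arr C Q Z. cmp C Y Q Z u q = h)) \<and>
        (\<forall>u\<in>arr C Q Z. \<forall>v\<in>arr C Q Z.
           (cmp C Y Q Z u q, cmp C Y Q Z v q) \<in> hom C Y Z \<longrightarrow> (u, v) \<in> hom C Q Z))"

text \<open>
  A weak pullback of \<open>f : A \<rightarrow> Z\<close> and \<open>g : B \<rightarrow> Z\<close>: the weak limit of the cospan with constant
  weight the one-point poset. Surjectivity of the comparison map concerns elements only, so the
  hom-orders play no role.
\<close>

definition weak_pullback :: "('o, 'm) pcat \<Rightarrow> 'o \<Rightarrow> 'o \<Rightarrow> 'o \<Rightarrow> 'm \<Rightarrow> 'm \<Rightarrow>
    'o \<Rightarrow> 'm \<Rightarrow> 'm \<Rightarrow> bool" where
  "weak_pullback C A B Z f g P p q \<longleftrightarrow>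
     P \<in> ob C \<and> p \<in> arr C P A \<and> q \<in> arr C P B \<and> cmp C P A Z f p = cmp C P B Z g q \<and>
     (\<forall>W\<in>ob C. \<forall>a\<in>arr C W A. \<forall>b\<in>arr C W B. cmp C W A Z f a = cmp C W B Z g b \<longrightarrow>
        (\<exists>u\<in>arr C W P. cmp C W P A p u = a \<and> cmp C W P B q u = b))"

section \<open>The category Pos\<close>

text \<open>
  Pos consists of the small posets, where smallness is a predicate on the subsets of a fixed type.
  For the usual reading of Pos take a Grothendieck universe and let the small sets be those
  equipollent to a member of it. Only the closure properties listed here are imposed, so that
  bounds by an arbitrary infinite cardinal are also covered.
\<close>

locale smallness =
  fixes small :: "'a set \<Rightarrow> bool"
  assumes small_subset: "\<lbrakk>small A; B \<subseteq> A\<rbrakk> \<Longrightarrow> small B"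
    and small_eqpoll: "\<lbrakk>small A; B \<approx> A\<rbrakk> \<Longrightarrow> small B"
    and small_times: "\<lbrakk>small A; small B\<rbrakk> \<Longrightarrow> \<exists>D. small D \<and> D \<approx> A \<times> B"

definition mono_map :: "'a rel \<Rightarrow> 'a rel \<Rightarrow> ('a \<Rightarrow> 'a) \<Rightarrow> bool" where
  "mono_map X Y f \<longleftrightarrow> f \<in> Field X \<rightarrow>\<^sub>E Field Y \<and>
     monotone_on (Field X) (\<lambda>x y. (x, y) \<in> X) (\<lambda>x y. (x, y) \<in> Y) f"

definition Pos :: "('a set \<Rightarrow> bool) \<Rightarrow> ('a rel, 'a \<Rightarrow> 'a) pcat" where
  "Pos small = \<lparr>
     ob = {X. Partial_order X \<and> small (Field X)},
     hom = \<lambda>X Y. {(f, g). mono_map X Y f \<and> mono_map X Y g \<and> (\<forall>x\<in>Field X. (f x, g x) \<in> Y)},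
     idn = \<lambda>X. (\<lambda>x\<in>Field X. x),
     cmp = \<lambda>X Y Z g f. compose (Field X) g f\<rparr>"

definition discrete :: "'a rel \<Rightarrow> bool" where
  "discrete X \<longleftrightarrow> X = Id_on (Field X)"

text \<open>
  A congruence on \<open>X\<close> is a preorder \<open>K\<close> on its carrier that contains the order. As a poset, \<open>K\<close> has
  the order induced from the product order on pairs; since pairs are not elements of the base type,
  that poset is given by a copy \<open>R\<close>, identified with \<open>K\<close> by the pairing of its two projections.
\<close>

definition is_congruence ::
    "'a rel \<Rightarrow> 'a rel \<Rightarrow> ('a \<Rightarrow> 'a) \<Rightarrow> ('a \<Rightarrow> 'a) \<Rightarrow> bool" where
  "is_congruence X R r0 r1 \<longleftrightarrow>
     mono_map R X r0 \<and> mono_map R X r1 \<and>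
     (\<exists>K. preorder_on (Field X) K \<and> X \<subseteq> K \<and> bij_betw (\<lambda>z. (r0 z, r1 z)) (Field R) K) \<and>
     (\<forall>z\<in>Field R. \<forall>w\<in>Field R. (z, w) \<in> R \<longleftrightarrow> (r0 z, r0 w) \<in> X \<and> (r1 z, r1 w) \<in> X)"

section \<open>Monads\<close>

record ('o, 'm) pmonad =
  endo :: "('o, 'm, 'o, 'm) pfun"
  eta :: "'o \<Rightarrow> 'm"
  mu :: "'o \<Rightarrow> 'm"

abbreviation Tob :: "('o, 'm) pmonad \<Rightarrow> 'o \<Rightarrow> 'o" where
  "Tob M \<equiv> fob (endo M)"

abbreviation Tmap :: "('o, 'm) pmonad \<Rightarrow> 'o \<Rightarrow> 'o \<Rightarrow> 'm \<Rightarrow> 'm" where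
  "Tmap M \<equiv> fmap (endo M)"

locale pos_monad = T: pos_functor C C "endo M"
  for C :: "('o, 'm) pcat" and M :: "('o, 'm) pmonad" +
  assumes eta_nat: "nat_trans C C id_fun (endo M) (eta M)"
    and mu_nat: "nat_trans C C (comp_fun (endo M) (endo M)) (endo M) (mu M)"
    and mu_eta: "X \<in> ob C \<Longrightarrow>
      cmp C (Tob M X) (Tob M (Tob M X)) (Tob M X) (mu M X) (eta M (Tob M X)) = idn C (Tob M X)"
    and mu_Teta: "X \<in> ob C \<Longrightarrow>
      cmp C (Tob M X) (Tob M (Tob M X)) (Tob M X) (mu M X) (Tmap M X (Tob M X) (eta M X))
      = idn C (Tob M X)"
    and mu_mu: "X \<in> ob C \<Longrightarrow>
      cmp C (Tob M (Tob M (Tob M X))) (Tob M (Tob M X)) (Tob M X) (mu M X) (mu M (Tob M X))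
      = cmp C (Tob M (Tob M (Tob M X))) (Tob M (Tob M X)) (Tob M X)
          (mu M X) (Tmap M (Tob M (Tob M X)) (Tob M X) (mu M X))"

definition EM_category :: "('o, 'm) pcat \<Rightarrow> ('o, 'm) pmonad \<Rightarrow> ('o \<times> 'm, 'm) pcat" where
  "EM_category C M = \<lparr>
     ob = {(A, a). A \<in> ob C \<and> a \<in> arr C (Tob M A) A \<and>
            cmp C A (Tob M A) A a (eta M A) = idn C A \<and>
            cmp C (Tob M (Tob M A)) (Tob M A) A a (mu M A)
            = cmp C (Tob M (Tob M A)) (Tob M A) A a (Tmap M (Tob M A) A a)},
     hom = \<lambda>(A, a) (B, b). Restr (hom C A B)
            {f. cmp C (Tob M A) A B f a = cmp C (Tob M A) (Tob M B) B b (Tmap M A B f)},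
     idn = \<lambda>(A, a). idn C A,
     cmp = \<lambda>(A, a) (B, b) (D, d). cmp C A B D\<rparr>"

text \<open>The object \<open>X\<close> of the Kleisli category stands for the free algebra on \<open>X\<close>.\<close>

definition kleisli :: "('o, 'm) pcat \<Rightarrow> ('o, 'm) pmonad \<Rightarrow> ('o, 'm) pcat" where
  "kleisli C M = \<lparr>
     ob = ob C,
     hom = \<lambda>X Y. hom C X (Tob M Y),
     idn = eta M,
     cmp = \<lambda>X Y Z g f. cmp C X (Tob M Y) (Tob M Z)
            (cmp C (Tob M Y) (Tob M (Tob M Z)) (Tob M Z) (mu M Z) (Tmap M Y (Tob M Z) g)) f\<rparr>"

definition kleisli_d ::
    "('a set \<Rightarrow> bool) \<Rightarrow> ('a rel, 'a \<Rightarrow> 'a) pmonad \<Rightarrow> ('a rel, 'a \<Rightarrow> 'a) pcat" where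
  "kleisli_d small M = full_sub (kleisli (Pos small) M) {X. discrete X}"

definition preserves_congruence_coinserters ::
    "('a set \<Rightarrow> bool) \<Rightarrow> ('a rel, 'a \<Rightarrow> 'a) pmonad \<Rightarrow> bool" where
  "preserves_congruence_coinserters small M \<longleftrightarrow>
     (\<forall>X\<in>ob (Pos small). \<forall>R\<in>ob (Pos small). \<forall>Q\<in>ob (Pos small). \<forall>r0 r1 q.
        is_congruence X R r0 r1 \<and> is_coinserter (Pos small) R X r0 r1 Q q \<longrightarrow>
        is_coinserter (Pos small) (Tob M R) (Tob M X) (Tmap M R X r0) (Tmap M R X r1)
          (Tob M Q) (Tmap M X Q q))"

section \<open>The category of pseudocongruences\<close>

record ('o, 'm) ppair =
  base :: 'o
  rel :: 'o
  leg0 :: 'm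
  leg1 :: 'm

text \<open>
  The transitivity condition asks for some weak pullback and a map \<open>\<tau>\<close> defined on it. In a weakly
  lex category weak pullbacks exist, and any two of them map to each other over their projections,
  so the choice is immaterial.
\<close>

definition pseudocongruence :: "('o, 'm) pcat \<Rightarrow> ('o, 'm) ppair \<Rightarrow> bool" where
  "pseudocongruence C P \<longleftrightarrow> (let X = base P; R = rel P; r0 = leg0 P; r1 = leg1 P in
     X \<in> ob C \<and> R \<in> ob C \<and> r0 \<in> arr C R X \<and> r1 \<in> arr C R X \<and>
     (\<forall>A\<in>ob C. \<forall>(a0, a1)\<in>hom C A X.
        \<exists>u\<in>arr C A R. cmp C A R X r0 u = a0 \<and> cmp C A R X r1 u = a1) \<and>
     (\<exists>RR d0 d1. weak_pullback C R R X r1 r0 RR d0 d1 \<and>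
        (\<exists>\<tau>\<in>arr C RR R. cmp C RR R X r0 \<tau> = cmp C RR R X r0 d0 \<and>
                        cmp C RR R X r1 \<tau> = cmp C RR R X r1 d1)))"

definition ppair_maps :: "('o, 'm) pcat \<Rightarrow> ('o, 'm) ppair \<Rightarrow> ('o, 'm) ppair \<Rightarrow> 'm set" where
  "ppair_maps C P Q = {f \<in> arr C (base P) (base Q). \<exists>h\<in>arr C (rel P) (rel Q).
     cmp C (rel P) (rel Q) (base Q) (leg0 Q) h = cmp C (rel P) (base P) (base Q) f (leg0 P) \<and>
     cmp C (rel P) (rel Q) (base Q) (leg1 Q) h = cmp C (rel P) (base P) (base Q) f (leg1 P)}"

definition ppair_le :: "('o, 'm) pcat \<Rightarrow> ('o, 'm) ppair \<Rightarrow> ('o, 'm) ppair \<Rightarrow> 'm rel" where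
  "ppair_le C P Q = {(f, g). f \<in> ppair_maps C P Q \<and> g \<in> ppair_maps C P Q \<and>
     (\<exists>\<Sigma>\<in>arr C (base P) (rel Q).
        cmp C (base P) (rel Q) (base Q) (leg0 Q) \<Sigma> = f \<and>
        cmp C (base P) (rel Q) (base Q) (leg1 Q) \<Sigma> = g)}"

definition ppair_class :: "('o, 'm) pcat \<Rightarrow> ('o, 'm) ppair \<Rightarrow> ('o, 'm) ppair \<Rightarrow> 'm \<Rightarrow> 'm set" where
  "ppair_class C P Q f = {g. (f, g) \<in> ppair_le C P Q \<and> (g, f) \<in> ppair_le C P Q}"

text \<open>
  In the composite, the union ranges over representatives; for pseudocongruences all of them
  contribute the same class.
\<close>

definition ex_completion :: "('o, 'm) pcat \<Rightarrow> (('o, 'm) ppair, 'm set) pcat" where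
  "ex_completion C = \<lparr>
     ob = {P. pseudocongruence C P},
     hom = \<lambda>P Q. {(ppair_class C P Q f, ppair_class C P Q g) | f g. (f, g) \<in> ppair_le C P Q},
     idn = \<lambda>P. ppair_class C P P (idn C (base P)),
     cmp = \<lambda>P Q S \<psi> \<phi>.
       (\<Union>g\<in>\<psi>. \<Union>f\<in>\<phi>. ppair_class C P S (cmp C (base P) (base Q) (base S) g f))\<rparr>"

end

theory Submission
  imports Defs
begin

text \<open>
  Say that a surjective algebra map \<open>q : T X \<rightarrow> A\<close>, with \<open>X\<close> discrete, presents \<open>A\<close> by a pair
  \<open>r0, r1 : R \<rightarrow> T X\<close> with \<open>R\<close> discrete if the image of \<open>T R\<close> in \<open>T X \<times> T X\<close> is
  \<open>{(s, t). q s \<le> q t}\<close>. Such a pair is a pseudocongruence, and every algebra has a presentation.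
  Conversely, a pseudocongruence induces a congruence \<open>K\<close> on \<open>T X\<close> (test the two axioms on one-point
  posets), and \<open>A = T X / K\<close> becomes an algebra presented by it: since \<open>T\<close> preserves coinserters of
  congruences and every monotone surjection is one, \<open>T\<close> preserves surjections, and \<open>T q\<close> is again
  a quotient map along which the structure map can be defined. Between presented algebras, a
  Kleisli map \<open>\<phi>\<close> represents the algebra map \<open>f\<close> iff \<open>q' \<phi> = f q \<eta>\<close>, and this matches the
  hom-posets of the two categories. Choosing presentations in both directions gives the equivalence.
\<close>

section \<open>Equivalences from spans of fully faithful functors\<close>

text \<open>Discreteness of \<open>X\<close> and \<open>R\<close> is what turns surjectivity into
  arrows: every function out of a discrete poset is monotone, so pointwise preimages assemble into a
  Kleisli map, though not canonically. Presentations and representatives are therefore arbitrary,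
  and the comparison is organised so that no choice has to be compatible with another. Its middle
  term consists of all triples of a pair, an algebra and a presenting map; an algebra map is sent to
  the set of all Kleisli maps that represent it, which turns out to be one full class of the
  completion. The delicate point is the structure map on \<open>T X / K\<close>. The hypothesis on
  \<open>T\<close> speaks of the congruence as a poset \<open>S\<close> with two projections to
  \<open>T X\<close>, whereas the pseudocongruence supplies only \<open>T R\<close>, which covers
  \<open>S\<close> but is in general not isomorphic to it. The inequality required on
  \<open>T S\<close> is therefore pulled back along the image under \<open>T\<close> of the cover of
  \<open>S\<close> by \<open>T R\<close>, again a surjection, and there it follows from the
  multiplication on \<open>R\<close>.\<close>

lemma pos_category_cmp_arr:
  assumes "pos_category C" "a \<in> ob C" "b \<in> ob C" "c \<in> ob C" "f \<in> arr C a b" "g \<in> arr C b c"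
  shows "cmp C a b c g f \<in> arr C a c"
proof -
  interpret pos_category C by fact
  have "(f, f) \<in> hom C a b" "(g, g) \<in> hom C b c"
    using assms(5,6) hom_poset[of a b] hom_poset[of b c] assms(2-4)
    by (auto simp: arr_def partial_order_on_def preorder_on_def refl_on_def)
  then show ?thesis
    using cmp_mono[of a b c f f g g] assms(2-4) by (auto simp: arr_def Field_def)
qed

lemma hom_arr: "(f, g) \<in> hom C a b \<Longrightarrow> f \<in> arr C a b \<and> g \<in> arr C a b"
  by (auto simp: arr_def Field_def)

lemma Field_map_prod_image: "Field (map_prod f f ` r) = f ` Field r"
  by (force simp: Field_def Domain_iff Range_iff image_iff)

lemma Partial_order_map_prod_image:
  assumes "Partial_order r" "inj_on f (Field r)"
  shows "Partial_order (map_prod f f ` r)"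
proof -
  have r: "Refl r" "trans r" "antisym r"
    using assms(1) by (auto simp: partial_order_on_def preorder_on_def)
  have F: "x \<in> Field r \<and> y \<in> Field r" if "(x, y) \<in> r" for x y using that by (auto simp: Field_def)
  have "Refl (map_prod f f ` r)"
    using r(1) by (auto simp: refl_on_def Field_map_prod_image)
  moreover have "trans (map_prod f f ` r)"
  proof (rule transI)
    fix x y z assume "(x, y) \<in> map_prod f f ` r" "(y, z) \<in> map_prod f f ` r"
    then obtain a b b' c where *: "(a, b) \<in> r" "(b', c) \<in> r" "x = f a" "y = f b" "y = f b'" "z = f c"
      by auto
    then have "b = b'" using assms(2) F by (metis inj_onD)
    then show "(x, z) \<in> map_prod f f ` r" using * r(2) by (auto dest: transD)
  qed
  moreover have "antisym (map_prod f f ` r)"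
  proof (rule antisymI)
    fix x y assume "(x, y) \<in> map_prod f f ` r" "(y, x) \<in> map_prod f f ` r"
    then obtain a b b' a' where *: "(a, b) \<in> r" "(b', a') \<in> r" "x = f a" "y = f b" "y = f b'" "x = f a'"
      by auto
    then have "b = b'" "a = a'" using assms(2) F by (metis inj_onD)+
    then show "x = y" using * r(3) by (auto dest: antisymD)
  qed
  ultimately show ?thesis by (simp add: partial_order_on_def preorder_on_def) (auto simp: Field_def)
qed

text \<open>
  \<open>E\<close> indexes the objects of the apex; both legs \<open>c\<close> and \<open>d\<close> are surjective on objects and fully
  faithful. That \<open>D\<close> is a category need not be assumed: it follows by transport along \<open>\<Psi>\<close>.
\<close>

locale pos_span = C: pos_category C
  for C :: "('o, 'm) pcat" and D :: "('p, 'n) pcat" +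
  fixes E :: "'e set" and c :: "'e \<Rightarrow> 'o" and d :: "'e \<Rightarrow> 'p"
    and \<Psi> :: "'e \<Rightarrow> 'e \<Rightarrow> 'm \<Rightarrow> 'n"
  assumes c_onto: "c ` E = ob C"
    and d_onto: "d ` E = ob D"
    and hom_eq: "\<lbrakk>i \<in> E; j \<in> E\<rbrakk> \<Longrightarrow> hom D (d i) (d j) = map_prod (\<Psi> i j) (\<Psi> i j) ` hom C (c i) (c j)"
    and inj: "\<lbrakk>i \<in> E; j \<in> E\<rbrakk> \<Longrightarrow> inj_on (\<Psi> i j) (arr C (c i) (c j))"
    and \<Psi>_idn: "i \<in> E \<Longrightarrow> \<Psi> i i (idn C (c i)) = idn D (d i)"
    and \<Psi>_cmp: "\<lbrakk>i \<in> E; j \<in> E; k \<in> E; f \<in> arr C (c i) (c j); g \<in> arr C (c j) (c k)\<rbrakk>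
      \<Longrightarrow> \<Psi> i k (cmp C (c i) (c j) (c k) g f) = cmp D (d i) (d j) (d k) (\<Psi> j k g) (\<Psi> i j f)"
begin

lemma c_ob [simp]: "i \<in> E \<Longrightarrow> c i \<in> ob C"
  using c_onto by auto

lemma d_ob [simp]: "i \<in> E \<Longrightarrow> d i \<in> ob D"
  using d_onto by auto

lemma arr_eq: "\<lbrakk>i \<in> E; j \<in> E\<rbrakk> \<Longrightarrow> arr D (d i) (d j) = \<Psi> i j ` arr C (c i) (c j)"
  by (simp add: arr_def hom_eq Field_map_prod_image)

lemma d_obE:
  assumes "a \<in> ob D"
  obtains i where "i \<in> E" "a = d i"
  using assms d_onto by blast

lemma \<Psi>_arr: "\<lbrakk>i \<in> E; j \<in> E; f \<in> arr C (c i) (c j)\<rbrakk> \<Longrightarrow> \<Psi> i j f \<in> arr D (d i) (d j)"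
  by (simp add: arr_eq)

lemma C_cmp_arr: "\<lbrakk>i \<in> E; j \<in> E; k \<in> E; f \<in> arr C (c i) (c j); g \<in> arr C (c j) (c k)\<rbrakk>
      \<Longrightarrow> cmp C (c i) (c j) (c k) g f \<in> arr C (c i) (c k)"
  by (simp add: pos_category_cmp_arr C.pos_category_axioms)

text \<open>Every object and arrow of \<open>D\<close> comes from \<open>C\<close>, so each law is
  an image of the same law in \<open>C\<close>. For the completion this replaces a direct check that
  composition of classes is well defined, monotone and associative.\<close>

lemma pos_category_codomain: "pos_category D"
proof
  fix a b assume "a \<in> ob D" "b \<in> ob D"
  then obtain i j where ij: "i \<in> E" "j \<in> E" "a = d i" "b = d j" using d_onto by (metis imageE)
  then show "Partial_order (hom D a b)"
    using Partial_order_map_prod_image[OF C.hom_poset inj[unfolded arr_def]] by (simp add: hom_eq)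
next
  fix a assume "a \<in> ob D"
  then obtain i where i: "i \<in> E" "a = d i" using d_onto by (metis imageE)
  then show "idn D a \<in> arr D a a"
    using C.idn_arr by (simp add: arr_eq flip: \<Psi>_idn)
next
  fix a b e f f' g g' assume "a \<in> ob D" "b \<in> ob D" "e \<in> ob D"
  and fg: "(f, f') \<in> hom D a b" "(g, g') \<in> hom D b e"
  then obtain i j k where ijk: "i \<in> E" "j \<in> E" "k \<in> E" "a = d i" "b = d j" "e = d k"
    by (elim d_obE) blast
  then obtain F F' G G' where *: "(F, F') \<in> hom C (c i) (c j)" "(G, G') \<in> hom C (c j) (c k)"
    "f = \<Psi> i j F" "f' = \<Psi> i j F'" "g = \<Psi> j k G" "g' = \<Psi> j k G'"
    using fg by (auto simp: hom_eq)
  have "(cmp C (c i) (c j) (c k) G F, cmp C (c i) (c j) (c k) G' F') \<in> hom C (c i) (c k)"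
    using * ijk by (simp add: C.cmp_mono)
  then show "(cmp D a b e g f, cmp D a b e g' f') \<in> hom D a e"
    using * ijk hom_arr[OF *(1)] hom_arr[OF *(2)] by (force simp: hom_eq \<Psi>_cmp[symmetric])
next
  fix a b f assume "a \<in> ob D" "b \<in> ob D" and f: "f \<in> arr D a b"
  then obtain i j where ij: "i \<in> E" "j \<in> E" "a = d i" "b = d j" using d_onto by (metis imageE)
  then obtain F where F: "F \<in> arr C (c i) (c j)" "f = \<Psi> i j F" using f by (auto simp: arr_eq)
  show "cmp D a a b f (idn D a) = f"
    using F ij C.idn_arr by (simp add: C.cmp_idn_right flip: \<Psi>_idn \<Psi>_cmp)
  show "cmp D a b b (idn D b) f = f"
    using F ij C.idn_arr by (simp add: C.cmp_idn_left flip: \<Psi>_idn \<Psi>_cmp)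
next
  fix a b e l f g h assume "a \<in> ob D" "b \<in> ob D" "e \<in> ob D" "l \<in> ob D"
  and fgh: "f \<in> arr D a b" "g \<in> arr D b e" "h \<in> arr D e l"
  then obtain i j k m where ijk: "i \<in> E" "j \<in> E" "k \<in> E" "m \<in> E" "a = d i" "b = d j" "e = d k" "l = d m"
    by (elim d_obE) blast
  then obtain F G H where *: "F \<in> arr C (c i) (c j)" "G \<in> arr C (c j) (c k)" "H \<in> arr C (c k) (c m)"
    "f = \<Psi> i j F" "g = \<Psi> j k G" "h = \<Psi> k m H"
    using fgh by (auto simp: arr_eq)
  then show "cmp D a b l (cmp D b e l h g) f = cmp D a e l h (cmp D a b e g f)"
    using ijk by (simp add: C_cmp_arr C.cmp_assoc flip: \<Psi>_cmp)
qed

sublocale D: pos_category D by (rule pos_category_codomain)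

text \<open>Two indices over the same object of \<open>C\<close> may have different images in
  \<open>D\<close>; the transported identity compares them. This makes the result independent of the
  chosen sections up to isomorphism.\<close>

lemma \<Psi>_idn_is_iso:
  assumes "i \<in> E" "j \<in> E" "c i = c j"
  shows "is_iso D (d i) (d j) (\<Psi> i j (idn C (c i)))"
proof -
  have id: "idn C (c i) \<in> arr C (c i) (c i)" using assms C.idn_arr by simp
  then have id': "idn C (c i) \<in> arr C (c i) (c j)" "idn C (c i) \<in> arr C (c j) (c i)"
    using assms by simp_all
  have "cmp D (d i) (d j) (d i) (\<Psi> j i (idn C (c i))) (\<Psi> i j (idn C (c i))) = idn D (d i)"
    using \<Psi>_cmp[OF assms(1,2,1) id'] assms id \<Psi>_idn[of i] by (simp add: C.cmp_idn_left)
  moreover have "cmp D (d j) (d i) (d j) (\<Psi> i j (idn C (c i))) (\<Psi> j i (idn C (c i))) = idn D (d j)"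
    using \<Psi>_cmp[OF assms(2,1,2) id'(2,1)] assms id \<Psi>_idn[of j] by (simp add: C.cmp_idn_left)
  ultimately show ?thesis
    using id' assms \<Psi>_arr unfolding is_iso_def by blast
qed

abbreviation inv\<Psi> :: "'e \<Rightarrow> 'e \<Rightarrow> 'n \<Rightarrow> 'm" where
  "inv\<Psi> i j \<equiv> inv_into (arr C (c i) (c j)) (\<Psi> i j)"

lemma inv\<Psi>_\<Psi>: "\<lbrakk>i \<in> E; j \<in> E; f \<in> arr C (c i) (c j)\<rbrakk> \<Longrightarrow> inv\<Psi> i j (\<Psi> i j f) = f"
  by (simp add: inj)

text \<open>Full faithfulness makes a span reversible, so every construction from \<open>C\<close>
  to \<open>D\<close> also yields its mirror image.\<close>

lemma pos_span_converse: "pos_span D C E d c inv\<Psi>"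
proof
  fix i j assume ij: "i \<in> E" "j \<in> E"
  have "map_prod (inv\<Psi> i j) (inv\<Psi> i j) ` map_prod (\<Psi> i j) (\<Psi> i j) ` hom C (c i) (c j)
      = (\<lambda>x. x) ` hom C (c i) (c j)"
    unfolding image_image
  proof (rule image_cong[OF refl])
    fix x assume "x \<in> hom C (c i) (c j)"
    then show "map_prod (inv\<Psi> i j) (inv\<Psi> i j) (map_prod (\<Psi> i j) (\<Psi> i j) x) = x"
      using hom_arr[of "fst x" "snd x" C "c i" "c j"] ij by (cases x) (simp add: inv\<Psi>_\<Psi>)
  qed
  then show "hom C (c i) (c j) = map_prod (inv\<Psi> i j) (inv\<Psi> i j) ` hom D (d i) (d j)"
    using ij by (simp add: hom_eq)
  show "inj_on (inv\<Psi> i j) (arr D (d i) (d j))"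
    using ij by (auto simp: arr_eq intro: inj_on_inv_into)
next
  fix i assume i: "i \<in> E"
  show "inv\<Psi> i i (idn D (d i)) = idn C (c i)"
    using i inv\<Psi>_\<Psi>[of i i "idn C (c i)"] C.idn_arr by (simp add: \<Psi>_idn)
next
  fix i j k f g assume ijk: "i \<in> E" "j \<in> E" "k \<in> E"
    and "f \<in> arr D (d i) (d j)" "g \<in> arr D (d j) (d k)"
  then obtain F G where "F \<in> arr C (c i) (c j)" "G \<in> arr C (c j) (c k)" "f = \<Psi> i j F" "g = \<Psi> j k G"
    by (auto simp: arr_eq)
  then show "inv\<Psi> i k (cmp D (d i) (d j) (d k) g f)
      = cmp C (c i) (c j) (c k) (inv\<Psi> j k g) (inv\<Psi> i j f)"
    using ijk by (simp add: inv\<Psi>_\<Psi> C_cmp_arr flip: \<Psi>_cmp)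
qed (auto simp: c_onto d_onto)

lemma pos_functor_section:
  assumes t: "\<And>a. a \<in> ob C \<Longrightarrow> t a \<in> E \<and> c (t a) = a"
  shows "pos_functor C D \<lparr>fob = \<lambda>a. d (t a), fmap = \<lambda>a b. \<Psi> (t a) (t b)\<rparr>"
proof
  fix a b f f' assume "a \<in> ob C" "b \<in> ob C" "(f, f') \<in> hom C a b"
  then show "(fmap \<lparr>fob = \<lambda>a. d (t a), fmap = \<lambda>a b. \<Psi> (t a) (t b)\<rparr> a b f,
      fmap \<lparr>fob = \<lambda>a. d (t a), fmap = \<lambda>a b. \<Psi> (t a) (t b)\<rparr> a b f')
      \<in> hom D (fob \<lparr>fob = \<lambda>a. d (t a), fmap = \<lambda>a b. \<Psi> (t a) (t b)\<rparr> a)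
          (fob \<lparr>fob = \<lambda>a. d (t a), fmap = \<lambda>a b. \<Psi> (t a) (t b)\<rparr> b)"
    using t[of a] t[of b] by (force simp: hom_eq)
next
  fix a assume "a \<in> ob C"
  then show "fmap \<lparr>fob = \<lambda>a. d (t a), fmap = \<lambda>a b. \<Psi> (t a) (t b)\<rparr> a a (idn C a)
      = idn D (fob \<lparr>fob = \<lambda>a. d (t a), fmap = \<lambda>a b. \<Psi> (t a) (t b)\<rparr> a)"
    using t[of a] \<Psi>_idn[of "t a"] by simp
next
  fix a b e f g assume "a \<in> ob C" "b \<in> ob C" "e \<in> ob C" "f \<in> arr C a b" "g \<in> arr C b e"
  then show "fmap \<lparr>fob = \<lambda>a. d (t a), fmap = \<lambda>a b. \<Psi> (t a) (t b)\<rparr> a e (cmp C a b e g f) =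
     cmp D (fob \<lparr>fob = \<lambda>a. d (t a), fmap = \<lambda>a b. \<Psi> (t a) (t b)\<rparr> a)
       (fob \<lparr>fob = \<lambda>a. d (t a), fmap = \<lambda>a b. \<Psi> (t a) (t b)\<rparr> b)
       (fob \<lparr>fob = \<lambda>a. d (t a), fmap = \<lambda>a b. \<Psi> (t a) (t b)\<rparr> e)
       (fmap \<lparr>fob = \<lambda>a. d (t a), fmap = \<lambda>a b. \<Psi> (t a) (t b)\<rparr> b e g)
       (fmap \<lparr>fob = \<lambda>a. d (t a), fmap = \<lambda>a b. \<Psi> (t a) (t b)\<rparr> a b f)"
    using t[of a] t[of b] t[of e] \<Psi>_cmp[of "t a" "t b" "t e" f g] by simp
qed (use t in auto)

theorem pos_equivalent: "pos_equivalent C D"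
proof -
  interpret R: pos_span D C E d c inv\<Psi> by (rule pos_span_converse)
  \<comment> \<open>For presentations, the sections \<open>t\<close> and \<open>s\<close> choose a
    presentation of each algebra and an algebra for each pseudocongruence. Nothing relates the two
    choices.\<close>
  define t where "t = inv_into E c"
  have t: "t a \<in> E \<and> c (t a) = a" if "a \<in> ob C" for a
    using that c_onto unfolding t_def by (metis f_inv_into_f inv_into_into)
  define s where "s = inv_into E d"
  have s: "s a \<in> E \<and> d (s a) = a" if "a \<in> ob D" for a
    using that d_onto unfolding s_def by (metis f_inv_into_f inv_into_into)
  define F where "F = \<lparr>fob = \<lambda>a. d (t a), fmap = \<lambda>a b. \<Psi> (t a) (t b)\<rparr>"
  define G where "G = \<lparr>fob = \<lambda>a. c (s a), fmap = \<lambda>a b. inv\<Psi> (s a) (s b)\<rparr>"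
  have F: "pos_functor C D F" unfolding F_def by (rule pos_functor_section[OF t])
  have G: "pos_functor D C G" unfolding G_def by (rule R.pos_functor_section[OF s])
  \<comment> \<open>The indices \<open>t a\<close> and \<open>s (d (t a))\<close> lie over the same
    object of \<open>D\<close>, and \<open>t (c (s b))\<close> and \<open>s b\<close> over the same
    object of \<open>C\<close>; the components are the transported identities of these
    objects.\<close>
  define \<alpha> where "\<alpha> = (\<lambda>a. inv\<Psi> (t a) (s (d (t a))) (idn D (d (t a))))"
  define \<beta> where "\<beta> = (\<lambda>b. \<Psi> (t (c (s b))) (s b) (idn C (c (s b))))"
  have \<alpha>: "nat_iso C C id_fun (comp_fun G F) \<alpha>"
    unfolding nat_iso_def nat_trans_def
  proof (intro conjI ballI)
    fix a assume a: "a \<in> ob C"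
    have *: "t a \<in> E" "s (d (t a)) \<in> E" "d (s (d (t a))) = d (t a)" "c (t a) = a"
      using t[OF a] s[of "d (t a)"] by auto
    then have "is_iso C a (c (s (d (t a)))) (\<alpha> a)"
      using R.\<Psi>_idn_is_iso[of "t a" "s (d (t a))"] by (simp add: \<alpha>_def)
    then show "is_iso C (fob id_fun a) (fob (comp_fun G F) a) (\<alpha> a)"
      and "\<alpha> a \<in> arr C (fob id_fun a) (fob (comp_fun G F) a)"
      by (simp_all add: is_iso_def id_fun_def comp_fun_def F_def G_def)
  next
    fix a b f assume a: "a \<in> ob C" and b: "b \<in> ob C" and f: "f \<in> arr C a b"
    have A: "t a \<in> E" "s (d (t a)) \<in> E" "d (s (d (t a))) = d (t a)" "c (t a) = a"
      using t[OF a] s[of "d (t a)"] by auto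
    have B: "t b \<in> E" "s (d (t b)) \<in> E" "d (s (d (t b))) = d (t b)" "c (t b) = b"
      using t[OF b] s[of "d (t b)"] by auto
    have g: "\<Psi> (t a) (t b) f \<in> arr D (d (t a)) (d (t b))" using A B f \<Psi>_arr[of "t a" "t b" f] by simp
    have fg: "inv\<Psi> (t a) (t b) (\<Psi> (t a) (t b) f) = f" using A B f inv\<Psi>_\<Psi>[of "t a" "t b" f] by simp
    \<comment> \<open>Both composites are the image, under the reversed span, of
      \<open>\<Psi> (t a) (t b) f\<close> composed with an identity of \<open>D\<close>, on one side
      or the other.\<close>
    show "cmp C (fob id_fun a) (fob id_fun b) (fob (comp_fun G F) b) (\<alpha> b) (fmap id_fun a b f)
        = cmp C (fob id_fun a) (fob (comp_fun G F) a) (fob (comp_fun G F) b)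
            (fmap (comp_fun G F) a b f) (\<alpha> a)"
      using R.\<Psi>_cmp[of "t a" "t b" "s (d (t b))" "\<Psi> (t a) (t b) f" "idn D (d (t b))"]
        R.\<Psi>_cmp[of "t a" "s (d (t a))" "s (d (t b))" "idn D (d (t a))" "\<Psi> (t a) (t b) f"]
        A B g fg D.idn_arr D.cmp_idn_left D.cmp_idn_right
      by (simp add: id_fun_def comp_fun_def F_def G_def \<alpha>_def)
  qed
  have \<beta>: "nat_iso D D (comp_fun F G) id_fun \<beta>"
    unfolding nat_iso_def nat_trans_def
  proof (intro conjI ballI)
    fix a assume a: "a \<in> ob D"
    have *: "s a \<in> E" "t (c (s a)) \<in> E" "c (t (c (s a))) = c (s a)" "d (s a) = a"
      using s[OF a] t[of "c (s a)"] by auto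
    then have "is_iso D (d (t (c (s a)))) a (\<beta> a)"
      using \<Psi>_idn_is_iso[of "t (c (s a))" "s a"] by (simp add: \<beta>_def)
    then show "is_iso D (fob (comp_fun F G) a) (fob id_fun a) (\<beta> a)"
      and "\<beta> a \<in> arr D (fob (comp_fun F G) a) (fob id_fun a)"
      by (simp_all add: is_iso_def id_fun_def comp_fun_def F_def G_def)
  next
    fix a b f assume a: "a \<in> ob D" and b: "b \<in> ob D" and f: "f \<in> arr D a b"
    have A: "s a \<in> E" "t (c (s a)) \<in> E" "c (t (c (s a))) = c (s a)" "d (s a) = a"
      using s[OF a] t[of "c (s a)"] by auto
    have B: "s b \<in> E" "t (c (s b)) \<in> E" "c (t (c (s b))) = c (s b)" "d (s b) = b"
      using s[OF b] t[of "c (s b)"] by auto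
    obtain g where g: "g \<in> arr C (c (s a)) (c (s b))" "f = \<Psi> (s a) (s b) g"
      using A B f arr_eq[of "s a" "s b"] by auto
    show "cmp D (fob (comp_fun F G) a) (fob (comp_fun F G) b) (fob id_fun b) (\<beta> b)
          (fmap (comp_fun F G) a b f)
        = cmp D (fob (comp_fun F G) a) (fob id_fun a) (fob id_fun b) (fmap id_fun a b f) (\<beta> a)"
      using \<Psi>_cmp[of "t (c (s a))" "t (c (s b))" "s b" g "idn C (c (s b))"]
        \<Psi>_cmp[of "t (c (s a))" "s a" "s b" "idn C (c (s a))" g]
        A B g inv\<Psi>_\<Psi> C.idn_arr C.cmp_idn_left C.cmp_idn_right
      by (simp add: id_fun_def comp_fun_def F_def G_def \<beta>_def)
  qed
  show ?thesis unfolding pos_equivalent_def using F G \<alpha> \<beta> by blast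
qed

end

section \<open>Posets and monotone maps\<close>

lemma ob_Pos: "X \<in> ob (Pos small) \<longleftrightarrow> Partial_order X \<and> small (Field X)"
  by (simp add: Pos_def)

lemma Pos_refl: "\<lbrakk>X \<in> ob (Pos small); x \<in> Field X\<rbrakk> \<Longrightarrow> (x, x) \<in> X"
  by (auto simp: ob_Pos partial_order_on_def preorder_on_def refl_on_def)

lemma Pos_trans: "\<lbrakk>X \<in> ob (Pos small); (x, y) \<in> X; (y, z) \<in> X\<rbrakk> \<Longrightarrow> (x, z) \<in> X"
  by (auto simp: ob_Pos partial_order_on_def preorder_on_def dest: transD)

lemma Pos_antisym: "\<lbrakk>X \<in> ob (Pos small); (x, y) \<in> X; (y, x) \<in> X\<rbrakk> \<Longrightarrow> x = y"
  by (auto simp: ob_Pos partial_order_on_def dest: antisymD)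

lemma Pos_Field: "(x, y) \<in> X \<Longrightarrow> x \<in> Field X \<and> y \<in> Field X"
  by (auto simp: Field_def)

lemma Pos_obI:
  assumes "X \<subseteq> B \<times> B" "\<And>x. x \<in> B \<Longrightarrow> (x, x) \<in> X"
    and "\<And>x y z. \<lbrakk>(x, y) \<in> X; (y, z) \<in> X\<rbrakk> \<Longrightarrow> (x, z) \<in> X"
    and "\<And>x y. \<lbrakk>(x, y) \<in> X; (y, x) \<in> X\<rbrakk> \<Longrightarrow> x = y"
    and "small B"
  shows "X \<in> ob (Pos small) \<and> Field X = B"
proof -
  have F: "Field X = B" using assms(1,2) by (auto simp: Field_def)
  have "refl_on B X" "trans X" "antisym X"
    using assms by (auto simp: refl_on_def intro: transI antisymI)
  then show ?thesis
    using assms(1,5) F by (simp add: ob_Pos partial_order_on_def preorder_on_def)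
qed

lemma mono_map_in: "\<lbrakk>mono_map X Y f; x \<in> Field X\<rbrakk> \<Longrightarrow> f x \<in> Field Y"
  by (auto simp: mono_map_def)

lemma mono_map_le: "\<lbrakk>mono_map X Y f; (x, y) \<in> X\<rbrakk> \<Longrightarrow> (f x, f y) \<in> Y"
  using Pos_Field[of x y X] by (auto simp: mono_map_def monotone_on_def)

lemma mono_map_ext: "mono_map X Y f \<Longrightarrow> f \<in> extensional (Field X)"
  by (auto simp: mono_map_def PiE_def)

lemma mono_mapI:
  "\<lbrakk>f \<in> extensional (Field X); \<And>x. x \<in> Field X \<Longrightarrow> f x \<in> Field Y;
    \<And>x y. (x, y) \<in> X \<Longrightarrow> (f x, f y) \<in> Y\<rbrakk> \<Longrightarrow> mono_map X Y f"
  by (auto simp: mono_map_def monotone_on_def PiE_def)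

lemma mono_map_eqI:
  "\<lbrakk>mono_map X Y f; mono_map X Z g; \<And>x. x \<in> Field X \<Longrightarrow> f x = g x\<rbrakk> \<Longrightarrow> f = g"
  by (blast intro: extensionalityI mono_map_ext)

lemma mono_map_compose:
  assumes "mono_map X Y f" "mono_map Y Z g"
  shows "mono_map X Z (compose (Field X) g f)"
proof (rule mono_mapI)
  fix x y assume xy: "(x, y) \<in> X"
  then show "(compose (Field X) g f x, compose (Field X) g f y) \<in> Z"
    using Pos_Field[OF xy] mono_map_le[OF assms(2) mono_map_le[OF assms(1) xy]]
    by (simp add: compose_eq)
qed (use assms in \<open>auto simp: compose_eq mono_map_in\<close>)

lemma mono_map_id: "mono_map X X (\<lambda>x\<in>Field X. x)"
  by (rule mono_mapI) (auto dest: Pos_Field)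

lemma mono_map_discrete:
  assumes "discrete X" "Y \<in> ob (Pos small)"
    and "f \<in> extensional (Field X)" "\<And>x. x \<in> Field X \<Longrightarrow> f x \<in> Field Y"
  shows "mono_map X Y f"
proof (rule mono_mapI)
  fix x y assume "(x, y) \<in> X"
  then have "(x, y) \<in> Id_on (Field X)" using assms(1) unfolding discrete_def by simp
  then have "x = y" "x \<in> Field X" by auto
  then show "(f x, f y) \<in> Y" using assms(4) Pos_refl[OF assms(2)] by auto
qed (use assms in auto)

lemma hom_Pos: "(f, g) \<in> hom (Pos small) X Y \<longleftrightarrow>
    mono_map X Y f \<and> mono_map X Y g \<and> (\<forall>x\<in>Field X. (f x, g x) \<in> Y)"
  by (simp add: Pos_def)

text \<open>Arrows are the elements related to something by the hom-order; reflexivity of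
  \<open>Y\<close> puts every monotone map below itself.\<close>

lemma arr_Pos: "Y \<in> ob (Pos small) \<Longrightarrow> f \<in> arr (Pos small) X Y \<longleftrightarrow> mono_map X Y f"
  by (auto simp: arr_def Field_def[of "hom (Pos small) X Y"] Domain_iff Range_iff hom_Pos
      intro: Pos_refl mono_map_in)

lemma cmp_Pos: "cmp (Pos small) X Y Z g f = compose (Field X) g f"
  by (simp add: Pos_def)

lemma idn_Pos: "idn (Pos small) X = (\<lambda>x\<in>Field X. x)"
  by (simp add: Pos_def)

context smallness
begin

text \<open>Pairs over the base type are not elements of it, so a set of pairs has to be indexed by
  a small set \<open>D\<close> of the base type together with two projections. Order kernels, weak
  pullbacks and the relation object of a presentation are all obtained in this way.\<close>

lemma small_pairs:
  assumes "small B" "small B'" "K \<subseteq> B \<times> B'"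
  obtains D p0 p1 where "small D" "p0 \<in> extensional D" "p1 \<in> extensional D"
    "bij_betw (\<lambda>z. (p0 z, p1 z)) D K"
proof -
  obtain D where D: "small D" "D \<approx> B \<times> B'" using small_times[OF assms(1,2)] by blast
  then obtain h where h: "bij_betw h D (B \<times> B')" by (auto simp: eqpoll_def)
  define D' where "D' = {z \<in> D. h z \<in> K}"
  have "h ` D' = h ` D \<inter> K" unfolding D'_def by blast
  then have "bij_betw h D' K"
    using h assms(3) unfolding bij_betw_def by (auto simp: D'_def inj_on_def)
  then have "bij_betw (\<lambda>z. ((\<lambda>z\<in>D'. fst (h z)) z, (\<lambda>z\<in>D'. snd (h z)) z)) D' K"
    by (simp cong: bij_betw_cong)
  then show thesis
    using that[of D' "\<lambda>z\<in>D'. fst (h z)" "\<lambda>z\<in>D'. snd (h z)"] D small_subset[of D D']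
    by (auto simp: D'_def)
qed

lemma Id_on_ob: "small B \<Longrightarrow> Id_on B \<in> ob (Pos small) \<and> Field (Id_on B) = B \<and> discrete (Id_on B)"
proof -
  assume "small B"
  then have "Id_on B \<in> ob (Pos small) \<and> Field (Id_on B) = B"
    by (intro Pos_obI) auto
  then show ?thesis by (simp add: discrete_def)
qed

end

section \<open>Algebras for a monad on posets\<close>

locale pos_monad_small = smallness small + monad: pos_monad "Pos small" M
  for small :: "'a set \<Rightarrow> bool" and M :: "('a rel, 'a \<Rightarrow> 'a) pmonad"
begin

abbreviation "Ps \<equiv> ob (Pos small)"

section \<open>Functoriality, naturality and the monad laws on elements\<close>

lemma T_ob [simp]: "X \<in> Ps \<Longrightarrow> Tob M X \<in> Ps"
  by (rule monad.T.fob_ob)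

lemma Tmap_mono_map:
  "\<lbrakk>X \<in> Ps; Y \<in> Ps; mono_map X Y f\<rbrakk> \<Longrightarrow> mono_map (Tob M X) (Tob M Y) (Tmap M X Y f)"
  using monad.T.fmap_mono[of X Y f f] by (auto simp: hom_Pos Pos_refl mono_map_in)

lemma Tmap_le:
  "\<lbrakk>X \<in> Ps; Y \<in> Ps; mono_map X Y f; mono_map X Y g; \<And>x. x \<in> Field X \<Longrightarrow> (f x, g x) \<in> Y;
    s \<in> Field (Tob M X)\<rbrakk> \<Longrightarrow> (Tmap M X Y f s, Tmap M X Y g s) \<in> Tob M Y"
  using monad.T.fmap_mono[of X Y f g] by (auto simp: hom_Pos)

lemma Tmap_compose:
  "\<lbrakk>X \<in> Ps; Y \<in> Ps; Z \<in> Ps; mono_map X Y f; mono_map Y Z g; s \<in> Field (Tob M X)\<rbrakk>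
    \<Longrightarrow> Tmap M X Z (compose (Field X) g f) s = Tmap M Y Z g (Tmap M X Y f s)"
  using monad.T.fmap_cmp[of X Y Z f g] by (simp add: arr_Pos cmp_Pos compose_eq)

lemma Tmap_id: "\<lbrakk>X \<in> Ps; s \<in> Field (Tob M X)\<rbrakk> \<Longrightarrow> Tmap M X X (\<lambda>x\<in>Field X. x) s = s"
  using monad.T.fmap_idn[of X] by (simp add: idn_Pos)

lemma eta_mono_map: "X \<in> Ps \<Longrightarrow> mono_map X (Tob M X) (eta M X)"
  using monad.eta_nat by (simp add: nat_trans_def id_fun_def arr_Pos)

lemma mu_mono_map: "X \<in> Ps \<Longrightarrow> mono_map (Tob M (Tob M X)) (Tob M X) (mu M X)"
  using monad.mu_nat by (simp add: nat_trans_def comp_fun_def arr_Pos)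

lemma eta_natural:
  assumes "X \<in> Ps" "Y \<in> Ps" "mono_map X Y f" "x \<in> Field X"
  shows "Tmap M X Y f (eta M X x) = eta M Y (f x)"
proof -
  have "compose (Field X) (eta M Y) f = compose (Field X) (Tmap M X Y f) (eta M X)"
    using monad.eta_nat assms by (simp add: nat_trans_def id_fun_def arr_Pos cmp_Pos)
  from fun_cong[OF this, of x] show ?thesis using assms(4) by (simp add: compose_eq)
qed

lemma mu_natural:
  assumes "X \<in> Ps" "Y \<in> Ps" "mono_map X Y f" "w \<in> Field (Tob M (Tob M X))"
  shows "mu M Y (Tmap M (Tob M X) (Tob M Y) (Tmap M X Y f) w) = Tmap M X Y f (mu M X w)"
proof -
  have "compose (Field (Tob M (Tob M X))) (mu M Y) (Tmap M (Tob M X) (Tob M Y) (Tmap M X Y f))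
      = compose (Field (Tob M (Tob M X))) (Tmap M X Y f) (mu M X)"
    using monad.mu_nat assms by (simp add: nat_trans_def comp_fun_def arr_Pos cmp_Pos)
  from fun_cong[OF this, of w] show ?thesis using assms(4) by (simp add: compose_eq)
qed

lemma mu_eta_app: "\<lbrakk>X \<in> Ps; s \<in> Field (Tob M X)\<rbrakk> \<Longrightarrow> mu M X (eta M (Tob M X) s) = s"
  using fun_cong[OF monad.mu_eta[of X], of s] by (simp add: cmp_Pos idn_Pos compose_eq)

lemma mu_Teta_app:
  "\<lbrakk>X \<in> Ps; s \<in> Field (Tob M X)\<rbrakk> \<Longrightarrow> mu M X (Tmap M X (Tob M X) (eta M X) s) = s"
  using fun_cong[OF monad.mu_Teta[of X], of s] by (simp add: cmp_Pos idn_Pos compose_eq)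

lemma mu_mu_app: "\<lbrakk>X \<in> Ps; w \<in> Field (Tob M (Tob M (Tob M X)))\<rbrakk>
    \<Longrightarrow> mu M X (mu M (Tob M X) w) = mu M X (Tmap M (Tob M (Tob M X)) (Tob M X) (mu M X) w)"
  using fun_cong[OF monad.mu_mu[of X], of w] by (simp add: cmp_Pos compose_eq)

section \<open>The Eilenberg-Moore category\<close>

definition alg :: "'a rel \<Rightarrow> ('a \<Rightarrow> 'a) \<Rightarrow> bool" where
  "alg A a \<longleftrightarrow> A \<in> Ps \<and> mono_map (Tob M A) A a \<and> (\<forall>x\<in>Field A. a (eta M A x) = x) \<and>
     (\<forall>w\<in>Field (Tob M (Tob M A)). a (mu M A w) = a (Tmap M (Tob M A) A a w))"

definition alg_hom ::
    "'a rel \<Rightarrow> ('a \<Rightarrow> 'a) \<Rightarrow> 'a rel \<Rightarrow> ('a \<Rightarrow> 'a) \<Rightarrow> ('a \<Rightarrow> 'a) \<Rightarrow> bool" where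
  "alg_hom A a B b f \<longleftrightarrow> mono_map A B f \<and> (\<forall>s\<in>Field (Tob M A). f (a s) = b (Tmap M A B f s))"

lemma compose_eq_iff: "compose A g f = compose A g' f' \<longleftrightarrow> (\<forall>x\<in>A. g (f x) = g' (f' x))"
  by (auto simp: compose_def fun_eq_iff restrict_def)

lemma compose_eq_id_iff: "compose A g f = (\<lambda>x\<in>A. x) \<longleftrightarrow> (\<forall>x\<in>A. g (f x) = x)"
  by (auto simp: compose_def fun_eq_iff restrict_def)

lemma EM_ob: "(A, a) \<in> ob (EM_category (Pos small) M) \<longleftrightarrow> alg A a"
  by (auto simp: EM_category_def alg_def arr_Pos cmp_Pos idn_Pos compose_eq_iff compose_eq_id_iff)

lemma EM_hom: "\<lbrakk>alg A a; alg B b\<rbrakk> \<Longrightarrow> (f, g) \<in> hom (EM_category (Pos small) M) (A, a) (B, b) \<longleftrightarrow>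
    alg_hom A a B b f \<and> alg_hom A a B b g \<and> (\<forall>x\<in>Field A. (f x, g x) \<in> B)"
  by (auto simp: EM_category_def alg_hom_def hom_Pos cmp_Pos compose_eq_iff)

text \<open>The field is unfolded at the hom-order alone, so that the carriers
  \<open>Field A\<close> and \<open>Field B\<close> stay intact.\<close>

lemma EM_arr: "\<lbrakk>alg A a; alg B b\<rbrakk> \<Longrightarrow>
    f \<in> arr (EM_category (Pos small) M) (A, a) (B, b) \<longleftrightarrow> alg_hom A a B b f"
  unfolding arr_def Field_def[of "hom _ _ _"] Un_iff Domain_iff Range_iff EM_hom
  by (auto simp: alg_hom_def alg_def intro: Pos_refl mono_map_in)

lemma EM_idn: "idn (EM_category (Pos small) M) (A, a) = (\<lambda>x\<in>Field A. x)"
  by (simp add: EM_category_def idn_Pos)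

lemma EM_cmp:
  "cmp (EM_category (Pos small) M) (A, a) (B, b) (D, d) g f = compose (Field A) g f"
  by (simp add: EM_category_def cmp_Pos)

lemma alg_hom_id: "alg A a \<Longrightarrow> alg_hom A a A a (\<lambda>x\<in>Field A. x)"
  by (auto simp: alg_hom_def alg_def mono_map_id Tmap_id mono_map_in)

lemma alg_hom_compose:
  assumes "alg A a" "alg B b" "alg D d" "alg_hom A a B b f" "alg_hom B b D d g"
  shows "alg_hom A a D d (compose (Field A) g f)"
  using assms by (auto simp: alg_hom_def alg_def compose_eq mono_map_compose Tmap_compose
      mono_map_in[of "Tob M A" A a] mono_map_in[OF Tmap_mono_map])

lemma pos_category_EM: "pos_category (EM_category (Pos small) M)"
proof
  fix p q assume "p \<in> ob (EM_category (Pos small) M)" "q \<in> ob (EM_category (Pos small) M)"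
  then obtain A a B b where pq: "p = (A, a)" "q = (B, b)" "alg A a" "alg B b"
    by (metis EM_ob surj_pair)
  then have "A \<in> Ps" "B \<in> Ps" by (auto simp: alg_def)
  let ?R = "{f. cmp (Pos small) (Tob M A) A B f a
      = cmp (Pos small) (Tob M A) (Tob M B) B b (Tmap M A B f)}"
  have "Partial_order (Restr (hom (Pos small) A B) ?R)"
    using monad.T.C.hom_poset[OF \<open>A \<in> Ps\<close> \<open>B \<in> Ps\<close>] by (rule Partial_order_Restr)
  then show "Partial_order (hom (EM_category (Pos small) M) p q)"
    by (simp add: EM_category_def pq)
next
  fix p assume "p \<in> ob (EM_category (Pos small) M)"
  then show "idn (EM_category (Pos small) M) p \<in> arr (EM_category (Pos small) M) p p"
    by (cases p) (simp add: EM_ob EM_arr EM_idn alg_hom_id)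
next
  fix p q r f f' g g'
  assume "p \<in> ob (EM_category (Pos small) M)" "q \<in> ob (EM_category (Pos small) M)"
    "r \<in> ob (EM_category (Pos small) M)"
    and fg: "(f, f') \<in> hom (EM_category (Pos small) M) p q"
    "(g, g') \<in> hom (EM_category (Pos small) M) q r"
  then obtain A a B b D d where
    pq: "p = (A, a)" "q = (B, b)" "r = (D, d)" "alg A a" "alg B b" "alg D d"
    by (metis EM_ob surj_pair)
  have "(g (f x), g' (f' x)) \<in> D" if x: "x \<in> Field A" for x
  proof -
    have "(f x, f' x) \<in> B" "f' x \<in> Field B" using fg x pq by (auto simp: EM_hom alg_hom_def mono_map_in)
    then have "(g (f x), g (f' x)) \<in> D" "(g (f' x), g' (f' x)) \<in> D"
      using fg pq by (auto simp: EM_hom alg_hom_def mono_map_le)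
    then show ?thesis using Pos_trans[of D small] pq(6) by (auto simp: alg_def)
  qed
  then show "(cmp (EM_category (Pos small) M) p q r g f, cmp (EM_category (Pos small) M) p q r g' f')
      \<in> hom (EM_category (Pos small) M) p r"
    using fg pq by (auto simp: EM_hom EM_cmp compose_eq intro!: alg_hom_compose[of A a B b])
next
  fix p q f
  assume "p \<in> ob (EM_category (Pos small) M)" "q \<in> ob (EM_category (Pos small) M)"
    and f: "f \<in> arr (EM_category (Pos small) M) p q"
  then obtain A a B b where pq: "p = (A, a)" "q = (B, b)" "alg A a" "alg B b"
    by (metis EM_ob surj_pair)
  then have f: "mono_map A B f" using f by (simp add: EM_arr alg_hom_def)
  show "cmp (EM_category (Pos small) M) p p q f (idn (EM_category (Pos small) M) p) = f"
    using mono_map_eqI[OF mono_map_compose[OF mono_map_id f] f] pq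
    by (simp add: EM_cmp EM_idn compose_eq)
  show "cmp (EM_category (Pos small) M) p q q (idn (EM_category (Pos small) M) q) f = f"
    using mono_map_eqI[OF mono_map_compose[OF f mono_map_id] f] pq
    by (simp add: EM_cmp EM_idn compose_eq mono_map_in[OF f])
next
  fix p q r s f g h
  assume "p \<in> ob (EM_category (Pos small) M)" "q \<in> ob (EM_category (Pos small) M)"
    "r \<in> ob (EM_category (Pos small) M)" "s \<in> ob (EM_category (Pos small) M)"
    and f: "f \<in> arr (EM_category (Pos small) M) p q"
  then obtain A a B b D d where pq: "p = (A, a)" "q = (B, b)" "alg A a" "alg B b" "r = (D, d)"
    by (metis EM_ob surj_pair)
  then show "cmp (EM_category (Pos small) M) p q s (cmp (EM_category (Pos small) M) q r s h g) f
      = cmp (EM_category (Pos small) M) p r s h (cmp (EM_category (Pos small) M) p q r g f)"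
    using f by (cases s) (auto simp: EM_arr alg_hom_def EM_cmp compose_def fun_eq_iff mono_map_in)
qed

section \<open>The universal property of free algebras\<close>

definition lift :: "'a rel \<Rightarrow> 'a rel \<Rightarrow> ('a \<Rightarrow> 'a) \<Rightarrow> ('a \<Rightarrow> 'a) \<Rightarrow> 'a \<Rightarrow> 'a" where
  "lift X A a f = compose (Field (Tob M X)) a (Tmap M X A f)"

lemma alg_free: "X \<in> Ps \<Longrightarrow> alg (Tob M X) (mu M X)"
  by (auto simp: alg_def mu_mono_map mu_eta_app mu_mu_app)

lemma lift_eta:
  assumes "X \<in> Ps" "alg A a" "mono_map X A f" "x \<in> Field X"
  shows "lift X A a f (eta M X x) = f x"
  using assms by (simp add: lift_def compose_eq eta_natural alg_def mono_map_in[OF eta_mono_map]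
      mono_map_in[OF assms(3)])

lemma lift_alg_hom:
  assumes X: "X \<in> Ps" and A: "alg A a" and f: "mono_map X A f"
  shows "alg_hom (Tob M X) (mu M X) A a (lift X A a f)"
  unfolding alg_hom_def
proof (intro conjI ballI)
  note P = A[unfolded alg_def, THEN conjunct1] A[unfolded alg_def, THEN conjunct2, THEN conjunct1]
  note Tf = Tmap_mono_map[OF X P(1) f]
  show "mono_map (Tob M X) A (lift X A a f)"
    unfolding lift_def using Tf P(2) by (rule mono_map_compose)
  fix w assume w: "w \<in> Field (Tob M (Tob M X))"
  have "lift X A a f (mu M X w) = a (Tmap M X A f (mu M X w))"
    using mono_map_in[OF mu_mono_map[OF X] w] by (simp add: lift_def compose_eq)
  also have "\<dots> = a (mu M A (Tmap M (Tob M X) (Tob M A) (Tmap M X A f) w))"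
    using mu_natural[OF X P(1) f w] by simp
  also have "\<dots> = a (Tmap M (Tob M A) A a (Tmap M (Tob M X) (Tob M A) (Tmap M X A f) w))"
    using A mono_map_in[OF Tmap_mono_map[OF T_ob[OF X] T_ob[OF P(1)] Tf] w]
    by (simp add: alg_def)
  also have "\<dots> = a (Tmap M (Tob M X) A (lift X A a f) w)"
    unfolding lift_def using Tmap_compose[OF T_ob[OF X] T_ob[OF P(1)] P(1) Tf P(2) w] by simp
  finally show "lift X A a f (mu M X w) = a (Tmap M (Tob M X) A (lift X A a f) w)" .
qed

text \<open>By a unit law, \<open>h\<close> is \<open>h\<close> after \<open>mu\<close> after
  \<open>T\<close> of the unit. Since \<open>h\<close> is an algebra map, this is \<open>a\<close>
  after \<open>T\<close> of the restriction of \<open>h\<close> to generators.\<close>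

lemma lift_unique:
  assumes X: "X \<in> Ps" and A: "alg A a" and h: "alg_hom (Tob M X) (mu M X) A a h"
    and eq: "\<And>x. x \<in> Field X \<Longrightarrow> h (eta M X x) = f x" and f: "mono_map X A f"
    and s: "s \<in> Field (Tob M X)"
  shows "h s = lift X A a f s"
proof -
  have P: "A \<in> Ps" "mono_map (Tob M X) A h" using A h by (auto simp: alg_def alg_hom_def)
  have "compose (Field X) h (eta M X) = f"
    using mono_map_compose[OF eta_mono_map[OF X] P(2)] f
    by (rule mono_map_eqI) (simp add: compose_eq eq)
  then have "lift X A a f s = a (Tmap M (Tob M X) A h (Tmap M X (Tob M X) (eta M X) s))"
    using Tmap_compose[OF X T_ob[OF X] P(1) eta_mono_map[OF X] P(2) s] s
    by (simp add: lift_def compose_eq)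
  also have "\<dots> = h (mu M X (Tmap M X (Tob M X) (eta M X) s))"
    using h mono_map_in[OF Tmap_mono_map[OF X T_ob[OF X] eta_mono_map[OF X]] s]
    by (simp add: alg_hom_def)
  finally show ?thesis using mu_Teta_app[OF X s] by simp
qed

text \<open>Local monotonicity of \<open>T\<close> enters here: inequalities between extensions to a
  free algebra can be tested on generators.\<close>

lemma lift_le:
  assumes "X \<in> Ps" "alg A a" "mono_map X A f" "mono_map X A g"
    and "\<And>x. x \<in> Field X \<Longrightarrow> (f x, g x) \<in> A" "s \<in> Field (Tob M X)"
  shows "(lift X A a f s, lift X A a g s) \<in> A"
  using assms Tmap_le[of X A f g s] mono_map_le[of "Tob M A" A a]
  by (simp add: lift_def compose_eq alg_def)

end

section \<open>Surjections as coinserters\<close>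

context smallness
begin

lemma is_coinserter_Pos:
  assumes "X \<in> ob (Pos small)" "Y \<in> ob (Pos small)" "Q \<in> ob (Pos small)"
    and f: "mono_map X Y f" and g: "mono_map X Y g"
  shows "is_coinserter (Pos small) X Y f g Q q \<longleftrightarrow>
    mono_map Y Q q \<and> (\<forall>x\<in>Field X. (q (f x), q (g x)) \<in> Q) \<and>
    (\<forall>Z\<in>ob (Pos small).
      (\<forall>h. mono_map Y Z h \<and> (\<forall>x\<in>Field X. (h (f x), h (g x)) \<in> Z) \<longrightarrow>
        (\<exists>u. mono_map Q Z u \<and> (\<forall>y\<in>Field Y. u (q y) = h y))) \<and>
      (\<forall>u v. mono_map Q Z u \<and> mono_map Q Z v \<and> (\<forall>y\<in>Field Y. (u (q y), v (q y)) \<in> Z) \<longrightarrow>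
        (\<forall>x\<in>Field Q. (u x, v x) \<in> Z)))"
proof -
  have comp: "(compose (Field X) h f, compose (Field X) h g) \<in> hom (Pos small) X Z
      \<longleftrightarrow> (\<forall>x\<in>Field X. (h (f x), h (g x)) \<in> Z)" if "mono_map Y Z h" for h Z
    using that f g by (auto simp: hom_Pos compose_eq mono_map_compose)
  have comp': "(compose (Field Y) u q, compose (Field Y) v q) \<in> hom (Pos small) Y Z
      \<longleftrightarrow> (\<forall>y\<in>Field Y. (u (q y), v (q y)) \<in> Z)"
    if "mono_map Q Z u" "mono_map Q Z v" "mono_map Y Q q" for u v Z
    using that by (auto simp: hom_Pos compose_eq mono_map_compose)
  have eq: "compose (Field Y) u q = h \<longleftrightarrow> (\<forall>y\<in>Field Y. u (q y) = h y)"
    if "mono_map Q Z u" "mono_map Y Z h" "mono_map Y Q q" for u h Z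
    using mono_map_eqI[OF mono_map_compose[OF that(3,1)] that(2)] by (auto simp: compose_eq)
  \<comment> \<open>The elementwise forms of the composites require \<open>q\<close> to be monotone;
    if it is not, both sides are false.\<close>
  show ?thesis
  proof (cases "mono_map Y Q q")
    case True
    show ?thesis
      unfolding is_coinserter_def cmp_Pos arr_Pos[OF assms(3)] comp[OF True]
      by (intro conj_cong refl ball_cong)
        (simp_all add: arr_Pos Ball_def[of "arr _ _ _"] Bex_def comp comp'[OF _ _ True] eq[OF _ _ True]
          cong: conj_cong imp_cong, auto simp: hom_Pos)
  qed (simp add: is_coinserter_def arr_Pos assms(3))
qed

text \<open>Corestricted to its image \<open>I\<close>, the map \<open>q\<close> still satisfies the
  inserted inequality, so it factors through \<open>q\<close> by some \<open>u\<close> into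
  \<open>I\<close>. Since \<open>u\<close> and the identity agree after \<open>q\<close>, uniqueness
  makes \<open>u\<close> the identity, and every point lies in \<open>I\<close>.\<close>

lemma coinserter_surj:
  assumes ob: "X \<in> ob (Pos small)" "Y \<in> ob (Pos small)" "Q \<in> ob (Pos small)"
    and fg: "mono_map X Y f" "mono_map X Y g"
    and coins: "is_coinserter (Pos small) X Y f g Q q"
  shows "q ` Field Y = Field Q"
proof -
  note * = coins[unfolded is_coinserter_Pos[OF ob fg]]
  have q: "mono_map Y Q q" using * by blast
  define I where "I = Restr Q (q ` Field Y)"
  have sub: "q ` Field Y \<subseteq> Field Q" using mono_map_in[OF q] by auto
  have "I \<in> ob (Pos small) \<and> Field I = q ` Field Y"
  proof (rule Pos_obI)
    show "small (q ` Field Y)" using small_subset[OF _ sub] ob(3) by (simp add: ob_Pos)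
  qed (use sub in \<open>auto simp: I_def intro: Pos_refl[OF ob(3)] Pos_trans[OF ob(3)] Pos_antisym[OF ob(3)]\<close>)
  then have I: "I \<in> ob (Pos small)" "Field I = q ` Field Y" by auto
  have qI: "mono_map Y I q"
    using mono_map_ext[OF q] mono_map_le[OF q]
    by (auto intro!: mono_mapI simp: I(2)) (auto simp: I_def dest: Pos_Field)
  have "\<forall>x\<in>Field X. (q (f x), q (g x)) \<in> I"
    using * mono_map_in[OF fg(1)] mono_map_in[OF fg(2)] by (auto simp: I_def)
  then obtain u where u: "mono_map Q I u" "\<forall>y\<in>Field Y. u (q y) = q y"
    using * I(1) qI by blast
  have uQ: "mono_map Q Q u"
    using mono_map_ext[OF u(1)] mono_map_in[OF u(1)] mono_map_le[OF u(1)] sub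
    by (auto intro!: mono_mapI simp: I) (auto simp: I_def)
  let ?i = "\<lambda>x\<in>Field Q. x"
  \<comment> \<open>The uniqueness clause of a coinserter is about inequalities; it is applied in
    both directions and antisymmetry concludes.\<close>
  have "\<forall>y\<in>Field Y. (u (q y), ?i (q y)) \<in> Q \<and> (?i (q y), u (q y)) \<in> Q"
    using u(2) mono_map_in[OF q] Pos_refl[OF ob(3)] by simp
  then have "\<forall>x\<in>Field Q. (u x, ?i x) \<in> Q" "\<forall>x\<in>Field Q. (?i x, u x) \<in> Q"
    using * ob(3) uQ mono_map_id[of Q] by blast+
  then have "u x = x" if "x \<in> Field Q" for x
    using that by (auto intro: Pos_antisym[OF ob(3)])
  then show ?thesis using mono_map_in[OF u(1)] I(2) sub by force
qed

text \<open>This is the comma object of \<open>e\<close> with itself: the pairs with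
  \<open>e x\<close> below \<open>e y\<close>, under the product order. \<open>R\<close> is a copy
  of it within the base type.\<close>

definition kernel_pair ::
    "'a rel \<Rightarrow> 'a rel \<Rightarrow> ('a \<Rightarrow> 'a) \<Rightarrow> 'a rel \<Rightarrow> ('a \<Rightarrow> 'a) \<Rightarrow> ('a \<Rightarrow> 'a) \<Rightarrow> bool" where
  "kernel_pair Y Z e R r0 r1 \<longleftrightarrow> R \<in> ob (Pos small) \<and> mono_map R Y r0 \<and> mono_map R Y r1 \<and>
     bij_betw (\<lambda>z. (r0 z, r1 z)) (Field R) {(x, y). x \<in> Field Y \<and> y \<in> Field Y \<and> (e x, e y) \<in> Z} \<and>
     (\<forall>z\<in>Field R. \<forall>w\<in>Field R. (z, w) \<in> R \<longleftrightarrow> (r0 z, r0 w) \<in> Y \<and> (r1 z, r1 w) \<in> Y)"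

text \<open>The product order is pulled back to the indexing set; it is antisymmetric there because
  the pairing of the projections is injective.\<close>

lemma kernel_pair_exists:
  assumes Y: "Y \<in> ob (Pos small)"
  obtains R r0 r1 where "kernel_pair Y Z e R r0 r1"
proof -
  let ?K = "{(x, y). x \<in> Field Y \<and> y \<in> Field Y \<and> (e x, e y) \<in> Z}"
  obtain D r0 r1 where D: "small D" "r0 \<in> extensional D" "r1 \<in> extensional D"
      and bij: "bij_betw (\<lambda>z. (r0 z, r1 z)) D ?K"
    using small_pairs[of "Field Y" "Field Y" ?K] Y by (auto simp: ob_Pos)
  have rY: "r0 z \<in> Field Y" "r1 z \<in> Field Y" if "z \<in> D" for z
    using bij_betw_apply[OF bij that] by auto
  have inj: "z = w" if "z \<in> D" "w \<in> D" "r0 z = r0 w" "r1 z = r1 w" for z w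
    using bij that by (auto simp: bij_betw_def inj_on_def)
  define R where "R = {(z, w). z \<in> D \<and> w \<in> D \<and> (r0 z, r0 w) \<in> Y \<and> (r1 z, r1 w) \<in> Y}"
  have "R \<in> ob (Pos small) \<and> Field R = D"
    using D(1) rY
    by (intro Pos_obI) (auto simp: R_def intro: Pos_refl[OF Y] Pos_trans[OF Y] inj Pos_antisym[OF Y])
  then have R: "R \<in> ob (Pos small)" "Field R = D" by auto
  have "kernel_pair Y Z e R r0 r1"
    unfolding kernel_pair_def R(2) using R(1) bij rY D(2,3)
    by (auto intro!: mono_mapI simp: R(2)) (auto simp: R_def)
  then show thesis by (rule that)
qed

lemma kernel_pairD:
  assumes "kernel_pair Y Z e R r0 r1"
  shows "R \<in> ob (Pos small)" "mono_map R Y r0" "mono_map R Y r1"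
    and "z \<in> Field R \<Longrightarrow> (e (r0 z), e (r1 z)) \<in> Z"
    and "\<lbrakk>x \<in> Field Y; y \<in> Field Y; (e x, e y) \<in> Z\<rbrakk> \<Longrightarrow> \<exists>!z. z \<in> Field R \<and> r0 z = x \<and> r1 z = y"
    and "\<lbrakk>z \<in> Field R; w \<in> Field R; (r0 z, r0 w) \<in> Y; (r1 z, r1 w) \<in> Y\<rbrakk> \<Longrightarrow> (z, w) \<in> R"
proof -
  let ?K = "{(x, y). x \<in> Field Y \<and> y \<in> Field Y \<and> (e x, e y) \<in> Z}"
  have bij: "bij_betw (\<lambda>z. (r0 z, r1 z)) (Field R) ?K" using assms by (simp add: kernel_pair_def)
  show "z \<in> Field R \<Longrightarrow> (e (r0 z), e (r1 z)) \<in> Z"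
    using bij_betw_apply[OF bij] by auto
  assume "x \<in> Field Y" "y \<in> Field Y" "(e x, e y) \<in> Z"
  then have "(x, y) \<in> (\<lambda>z. (r0 z, r1 z)) ` Field R" using bij by (simp add: bij_betw_def)
  then obtain z where z: "z \<in> Field R" "r0 z = x" "r1 z = y" by auto
  show "\<exists>!z. z \<in> Field R \<and> r0 z = x \<and> r1 z = y"
  proof (rule ex1I[of _ z])
    fix w assume "w \<in> Field R \<and> r0 w = x \<and> r1 w = y"
    then show "w = z" using z inj_onD[OF bij_betw_imp_inj_on[OF bij], of w z] by simp
  qed (use z in simp)
qed (use assms in \<open>auto simp: kernel_pair_def\<close>)

lemma kernel_pair_congruence:
  assumes Y: "Y \<in> ob (Pos small)" and Z: "Z \<in> ob (Pos small)" and e: "mono_map Y Z e"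
    and R: "kernel_pair Y Z e R r0 r1"
  shows "is_congruence Y R r0 r1"
proof -
  let ?K = "{(x, y). x \<in> Field Y \<and> y \<in> Field Y \<and> (e x, e y) \<in> Z}"
  have "preorder_on (Field Y) ?K"
    unfolding preorder_on_def
    by (auto simp: refl_on_def intro!: transI Pos_refl[OF Z] mono_map_in[OF e] intro: Pos_trans[OF Z])
  moreover have "Y \<subseteq> ?K" using mono_map_le[OF e] by (auto dest: Pos_Field)
  ultimately show ?thesis using R unfolding is_congruence_def kernel_pair_def by blast
qed

text \<open>If \<open>h\<close> respects the kernel, then \<open>e x\<close> below
  \<open>e y\<close> forces \<open>h x\<close> below \<open>h y\<close>. Antisymmetry in the target
  makes \<open>h\<close> constant on fibres, so it descends along arbitrary preimages, and the same
  implication makes the descended map monotone.\<close>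

lemma surj_coinserter:
  assumes Y: "Y \<in> ob (Pos small)" and Z: "Z \<in> ob (Pos small)" and e: "mono_map Y Z e"
    and surj: "e ` Field Y = Field Z" and R: "kernel_pair Y Z e R r0 r1"
  shows "is_coinserter (Pos small) R Y r0 r1 Z e"
  unfolding is_coinserter_Pos[OF kernel_pairD(1)[OF R] Y Z kernel_pairD(2,3)[OF R]]
proof (intro conjI ballI allI impI)
  fix W h assume W: "W \<in> ob (Pos small)"
    and h: "mono_map Y W h \<and> (\<forall>z\<in>Field R. (h (r0 z), h (r1 z)) \<in> W)"
  have le: "(h x, h y) \<in> W" if "x \<in> Field Y" "y \<in> Field Y" "(e x, e y) \<in> Z" for x y
    using kernel_pairD(5)[OF R that] h by blast
  define u where "u = (\<lambda>x\<in>Field Z. h (inv_into (Field Y) e x))"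
  have s: "inv_into (Field Y) e x \<in> Field Y" "e (inv_into (Field Y) e x) = x" if "x \<in> Field Z" for x
    using that surj by (auto intro: inv_into_into f_inv_into_f)
  have "mono_map Z W u"
  proof (rule mono_mapI)
    fix x y assume xy: "(x, y) \<in> Z"
    then show "(u x, u y) \<in> W"
      using Pos_Field[OF xy] s[of x] s[of y] by (auto simp: u_def intro!: le)
  qed (use s h in \<open>auto simp: u_def mono_map_in\<close>)
  moreover have "u (e y) = h y" if y: "y \<in> Field Y" for y
    using y mono_map_in[OF e y] s[of "e y"] Pos_refl[OF Z, of "e y"]
    by (auto simp: u_def intro!: Pos_antisym[OF W] le)
  ultimately show "\<exists>u. mono_map Z W u \<and> (\<forall>y\<in>Field Y. u (e y) = h y)" by blast
next
  fix W u v x assume "W \<in> ob (Pos small)"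
    "mono_map Z W u \<and> mono_map Z W v \<and> (\<forall>y\<in>Field Y. (u (e y), v (e y)) \<in> W)" "x \<in> Field Z"
  moreover from this obtain y where "y \<in> Field Y" "x = e y" using surj by blast
  ultimately show "(u x, v x) \<in> W" by blast
qed (use e kernel_pairD(4)[OF R] in auto)

text \<open>Equivalence classes would leave the base type, so the quotient consists of chosen
  representatives inside \<open>Field Y\<close>. This also makes it small.\<close>

lemma quotient_exists:
  assumes Y: "Y \<in> ob (Pos small)" and K: "K \<subseteq> Field Y \<times> Field Y" "Y \<subseteq> K" "trans K"
  obtains Q q where "Q \<in> ob (Pos small)" "mono_map Y Q q" "q ` Field Y = Field Q"
    "\<And>s t. \<lbrakk>s \<in> Field Y; t \<in> Field Y\<rbrakk> \<Longrightarrow> (q s, q t) \<in> Q \<longleftrightarrow> (s, t) \<in> K"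
proof -
  define q where "q = (\<lambda>s\<in>Field Y. SOME t. (s, t) \<in> K \<and> (t, s) \<in> K)"
  have refl: "(s, s) \<in> K" if "s \<in> Field Y" for s using that Pos_refl[OF Y] K(2) by auto
  have q: "(s, q s) \<in> K \<and> (q s, s) \<in> K" if "s \<in> Field Y" for s
    using someI[of "\<lambda>t. (s, t) \<in> K \<and> (t, s) \<in> K" s] refl that by (simp add: q_def)
  have qY: "q s \<in> Field Y" if "s \<in> Field Y" for s using q[OF that] K(1) by auto
  \<comment> \<open>Equivalent elements have extensionally equal predicates under
    \<open>SOME\<close>, hence the same representative.\<close>
  have qeq: "q s = q t" if "(s, t) \<in> K" "(t, s) \<in> K" for s t
  proof -
    have "(s, r) \<in> K \<and> (r, s) \<in> K \<longleftrightarrow> (t, r) \<in> K \<and> (r, t) \<in> K" for r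
      using that K(3) by (meson transD)
    then show ?thesis using that K(1) by (auto simp: q_def)
  qed
  define Q where "Q = Restr K (q ` Field Y)"
  have iff: "(q s, q t) \<in> Q \<longleftrightarrow> (s, t) \<in> K" if "s \<in> Field Y" "t \<in> Field Y" for s t
    using q[OF that(1)] q[OF that(2)] that K(3) unfolding Q_def by (auto dest: transD)
  have "q ` Field Y \<subseteq> Field Y" using qY by auto
  then have small: "small (q ` Field Y)" using Y small_subset by (auto simp: ob_Pos)
  have "Q \<in> ob (Pos small) \<and> Field Q = q ` Field Y"
  proof (rule Pos_obI)
    fix x y assume "(x, y) \<in> Q" "(y, x) \<in> Q"
    then obtain s t where "s \<in> Field Y" "t \<in> Field Y" "x = q s" "y = q t"
      by (auto simp: Q_def)
    then show "x = y"
      using \<open>(x, y) \<in> Q\<close> \<open>(y, x) \<in> Q\<close> iff[of s t] iff[of t s] qeq[of s t] by simp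
  qed (use refl qY small in \<open>auto simp: Q_def dest: transD[OF K(3)]\<close>)
  then have Q: "Q \<in> ob (Pos small)" "Field Q = q ` Field Y" by auto
  have "mono_map Y Q q"
  proof (rule mono_mapI)
    fix x y assume xy: "(x, y) \<in> Y"
    then show "(q x, q y) \<in> Q" using iff Pos_Field[OF xy] K(2) by auto
  qed (auto simp: Q q_def)
  then show thesis using that Q iff by blast
qed

end

section \<open>The action of the monad on monotone surjections\<close>

locale pos_monad_congruence = pos_monad_small +
  assumes preserves: "preserves_congruence_coinserters small M"
begin

lemma T_coinserter:
  assumes "Y \<in> Ps" "Z \<in> Ps" "mono_map Y Z e" "e ` Field Y = Field Z" "kernel_pair Y Z e R r0 r1"
  shows "is_coinserter (Pos small) (Tob M R) (Tob M Y) (Tmap M R Y r0) (Tmap M R Y r1)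
    (Tob M Z) (Tmap M Y Z e)"
  using preserves surj_coinserter[OF assms] kernel_pair_congruence[OF assms(1-3,5)]
    kernel_pairD(1)[OF assms(5)] assms(1,2)
  unfolding preserves_congruence_coinserters_def by blast

lemma T_surj:
  assumes "Y \<in> Ps" "Z \<in> Ps" "mono_map Y Z e" "e ` Field Y = Field Z"
  shows "Tmap M Y Z e ` Field (Tob M Y) = Field (Tob M Z)"
proof -
  obtain R r0 r1 where R: "kernel_pair Y Z e R r0 r1" using kernel_pair_exists[OF assms(1)] .
  show ?thesis
    using coinserter_surj[OF _ _ _ _ _ T_coinserter[OF assms R]] kernel_pairD(1-3)[OF R] assms(1,2)
    by (simp add: Tmap_mono_map)
qed

lemma T_factor:
  assumes "Y \<in> Ps" "Z \<in> Ps" "mono_map Y Z e" "e ` Field Y = Field Z"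
    and R: "kernel_pair Y Z e R r0 r1"
    and h: "W \<in> Ps" "mono_map (Tob M Y) W h"
      "\<And>\<zeta>. \<zeta> \<in> Field (Tob M R) \<Longrightarrow> (h (Tmap M R Y r0 \<zeta>), h (Tmap M R Y r1 \<zeta>)) \<in> W"
  obtains u where "mono_map (Tob M Z) W u" "\<And>w. w \<in> Field (Tob M Y) \<Longrightarrow> u (Tmap M Y Z e w) = h w"
proof -
  \<comment> \<open>These five facts are, in order, the side conditions for the elementwise form of
    the coinserter.\<close>
  note T_ob[OF kernel_pairD(1)[OF R]] T_ob[OF assms(1)] T_ob[OF assms(2)]
    Tmap_mono_map[OF kernel_pairD(1)[OF R] assms(1) kernel_pairD(2)[OF R]]
    Tmap_mono_map[OF kernel_pairD(1)[OF R] assms(1) kernel_pairD(3)[OF R]]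
  from T_coinserter[OF assms(1-4) R, unfolded is_coinserter_Pos[OF this]]
  show thesis using h that by blast
qed

end

section \<open>Presentations of algebras\<close>

text \<open>Discrete posets are projective for monotone surjections, because pointwise witnesses
  automatically form a monotone map. The lifts and the witnesses of the pseudocongruence axioms are
  found in this way.\<close>

lemma discrete_choice:
  assumes "W \<in> ob (Pos small)" "discrete W" "Y \<in> ob (Pos small)"
    and "\<And>w. w \<in> Field W \<Longrightarrow> \<exists>y\<in>Field Y. \<phi> w y"
  obtains u where "mono_map W Y u" "\<And>w. w \<in> Field W \<Longrightarrow> \<phi> w (u w)"
proof -
  obtain v where v: "\<And>w. w \<in> Field W \<Longrightarrow> v w \<in> Field Y \<and> \<phi> w (v w)"
    using assms(4) by metis
  have "mono_map W Y (\<lambda>w\<in>Field W. v w)"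
    by (rule mono_map_discrete[OF assms(2,3)]) (use v in auto)
  then show thesis using that v by simp
qed

context pos_monad_small
begin

abbreviation "Kl \<equiv> kleisli_d small M"

abbreviation ext :: "'a rel \<Rightarrow> 'a rel \<Rightarrow> ('a \<Rightarrow> 'a) \<Rightarrow> 'a \<Rightarrow> 'a" where
  "ext X Y \<equiv> lift X (Tob M Y) (mu M Y)"

section \<open>The Kleisli category on discrete posets\<close>

lemma Kl_ob: "X \<in> ob Kl \<longleftrightarrow> X \<in> Ps \<and> discrete X"
  by (simp add: kleisli_d_def full_sub_def kleisli_def)

lemma Kl_arr: "Y \<in> Ps \<Longrightarrow> f \<in> arr Kl X Y \<longleftrightarrow> mono_map X (Tob M Y) f"
  using arr_Pos[of "Tob M Y" small f X] by (simp add: arr_def kleisli_d_def full_sub_def kleisli_def)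

lemma Kl_hom: "(f, g) \<in> hom Kl X Y \<longleftrightarrow> mono_map X (Tob M Y) f \<and> mono_map X (Tob M Y) g \<and>
    (\<forall>x\<in>Field X. (f x, g x) \<in> Tob M Y)"
  by (simp add: kleisli_d_def full_sub_def kleisli_def hom_Pos)

lemma Kl_cmp: "cmp Kl X Y Z g f = compose (Field X) (ext Y Z g) f"
  by (simp add: kleisli_d_def full_sub_def kleisli_def cmp_Pos lift_def)

lemma Kl_idn: "idn Kl X = eta M X"
  by (simp add: kleisli_d_def full_sub_def kleisli_def)

lemma ext_mono_map:
  "\<lbrakk>X \<in> Ps; Y \<in> Ps; mono_map X (Tob M Y) f\<rbrakk> \<Longrightarrow> mono_map (Tob M X) (Tob M Y) (ext X Y f)"
  using lift_alg_hom alg_free by (auto simp: alg_hom_def)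

text \<open>Both sides are algebra maps out of a free algebra that agree on generators. For free
  \<open>A\<close> and \<open>B\<close> and an extended \<open>h\<close>, this says that extension
  turns Kleisli composition into composition of functions.\<close>

lemma alg_hom_lift:
  assumes "X \<in> Ps" "alg B b" "alg A a" "alg_hom B b A a h" "mono_map X B f" "s \<in> Field (Tob M X)"
  shows "h (lift X B b f s) = lift X A a (compose (Field X) h f) s"
proof -
  have h: "mono_map B A h" using assms(4) by (simp add: alg_hom_def)
  let ?k = "compose (Field (Tob M X)) h (lift X B b f)"
  have "alg_hom (Tob M X) (mu M X) A a ?k"
    using alg_hom_compose[OF alg_free] lift_alg_hom assms by blast
  from lift_unique[OF assms(1,3) this _ mono_map_compose[OF assms(5) h] assms(6)]
  show ?thesis
    using assms(1,2,5,6) by (simp add: compose_eq lift_eta mono_map_in[OF eta_mono_map])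
qed

text \<open>The legs are Kleisli arrows, so they act on \<open>T R\<close> through their extensions.
  \<open>T R\<close> is asked to cover the order kernel of \<open>q\<close> without joint
  injectivity, matching the weakness of pseudocongruences.\<close>

definition presents ::
    "('a rel, 'a \<Rightarrow> 'a) ppair \<Rightarrow> 'a rel \<Rightarrow> ('a \<Rightarrow> 'a) \<Rightarrow> ('a \<Rightarrow> 'a) \<Rightarrow> bool" where
  "presents P A a q \<longleftrightarrow> base P \<in> ob Kl \<and> rel P \<in> ob Kl \<and>
     leg0 P \<in> arr Kl (rel P) (base P) \<and> leg1 P \<in> arr Kl (rel P) (base P) \<and>
     alg A a \<and> alg_hom (Tob M (base P)) (mu M (base P)) A a q \<and>
     q ` Field (Tob M (base P)) = Field A \<and>
     (\<forall>s\<in>Field (Tob M (base P)). \<forall>t\<in>Field (Tob M (base P)). (q s, q t) \<in> A \<longleftrightarrow>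
        (\<exists>z\<in>Field (Tob M (rel P)). ext (rel P) (base P) (leg0 P) z = s \<and>
           ext (rel P) (base P) (leg1 P) z = t))"

lemma presentsD:
  assumes "presents P A a q"
  shows "base P \<in> Ps" "discrete (base P)" "rel P \<in> Ps" "discrete (rel P)"
    "mono_map (rel P) (Tob M (base P)) (leg0 P)" "mono_map (rel P) (Tob M (base P)) (leg1 P)"
    "alg A a" "A \<in> Ps" "alg_hom (Tob M (base P)) (mu M (base P)) A a q"
    "mono_map (Tob M (base P)) A q" "q ` Field (Tob M (base P)) = Field A"
  using assms by (auto simp: presents_def Kl_ob Kl_arr alg_def alg_hom_def)

lemma presents_kernel:
  assumes "presents P A a q" "s \<in> Field (Tob M (base P))" "t \<in> Field (Tob M (base P))"
    "(q s, q t) \<in> A"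
  obtains z where "z \<in> Field (Tob M (rel P))" "ext (rel P) (base P) (leg0 P) z = s"
    "ext (rel P) (base P) (leg1 P) z = t"
  using assms by (auto simp: presents_def)

lemma presents_legs:
  assumes "presents P A a q" "z \<in> Field (Tob M (rel P))"
  shows "ext (rel P) (base P) (leg0 P) z \<in> Field (Tob M (base P))"
    "ext (rel P) (base P) (leg1 P) z \<in> Field (Tob M (base P))"
    "(q (ext (rel P) (base P) (leg0 P) z), q (ext (rel P) (base P) (leg1 P) z)) \<in> A"
proof -
  note * = presentsD[OF assms(1)]
  show "ext (rel P) (base P) (leg0 P) z \<in> Field (Tob M (base P))"
    "ext (rel P) (base P) (leg1 P) z \<in> Field (Tob M (base P))"
    using mono_map_in[OF ext_mono_map[OF *(3,1,5)] assms(2)]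
      mono_map_in[OF ext_mono_map[OF *(3,1,6)] assms(2)] by auto
  then show "(q (ext (rel P) (base P) (leg0 P) z), q (ext (rel P) (base P) (leg1 P) z)) \<in> A"
    using assms by (auto simp: presents_def)
qed

text \<open>Both axioms amount to facts about the order of \<open>A\<close>: monotonicity of
  \<open>q\<close> gives the first, transitivity of \<open>A\<close> the second. The kernel clause
  supplies preimages in \<open>T R\<close>, chosen over a discrete domain.\<close>

lemma presents_pseudocongruence:
  assumes P: "presents P A a q"
  shows "pseudocongruence Kl P"
proof -
  define X R r0 r1 where defs: "X = base P" "R = rel P" "r0 = leg0 P" "r1 = leg1 P"
  note * = presentsD[OF P, folded defs] and kernel = presents_kernel[OF P, folded defs]
    and legs = presents_legs[OF P, folded defs]
  have "\<exists>u\<in>arr Kl W R. cmp Kl W R X r0 u = f0 \<and> cmp Kl W R X r1 u = f1"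
    if W: "W \<in> ob Kl" and f: "(f0, f1) \<in> hom Kl W X" for W f0 f1
  proof -
    have f': "mono_map W (Tob M X) f0" "mono_map W (Tob M X) f1"
      "\<And>w. w \<in> Field W \<Longrightarrow> (f0 w, f1 w) \<in> Tob M X" using f by (auto simp: Kl_hom)
    have "\<exists>z\<in>Field (Tob M R). ext R X r0 z = f0 w \<and> ext R X r1 z = f1 w" if w: "w \<in> Field W" for w
      using kernel[OF mono_map_in[OF f'(1) w] mono_map_in[OF f'(2) w]
          mono_map_le[OF *(10) f'(3)[OF w]]] by blast
    then obtain u where u: "mono_map W (Tob M R) u"
      "\<And>w. w \<in> Field W \<Longrightarrow> ext R X r0 (u w) = f0 w \<and> ext R X r1 (u w) = f1 w"
      using discrete_choice[of W small "Tob M R" "\<lambda>w z. ext R X r0 z = f0 w \<and> ext R X r1 z = f1 w"]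
        W T_ob[OF *(3)] unfolding Kl_ob by blast
    have "cmp Kl W R X r0 u = f0" "cmp Kl W R X r1 u = f1" unfolding Kl_cmp
      using mono_map_eqI[OF mono_map_compose[OF u(1) ext_mono_map[OF *(3,1,5)]] f'(1)]
        mono_map_eqI[OF mono_map_compose[OF u(1) ext_mono_map[OF *(3,1,6)]] f'(2)] u(2)
      by (simp_all add: compose_eq)
    then show ?thesis using u(1) *(3) by (auto simp: Kl_arr)
  qed
  moreover have "\<exists>RR d0 d1. weak_pullback Kl R R X r1 r0 RR d0 d1 \<and>
     (\<exists>\<tau>\<in>arr Kl RR R. cmp Kl RR R X r0 \<tau> = cmp Kl RR R X r0 d0 \<and>
                        cmp Kl RR R X r1 \<tau> = cmp Kl RR R X r1 d1)"
  proof -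
    \<comment> \<open>The weak pullback is the set-level pullback of the extended legs, taken as a
      discrete poset of generators.\<close>
    let ?K = "{(z, w). z \<in> Field (Tob M R) \<and> w \<in> Field (Tob M R) \<and> ext R X r1 z = ext R X r0 w}"
    obtain D d0 d1 where D: "small D" "d0 \<in> extensional D" "d1 \<in> extensional D"
      and bij: "bij_betw (\<lambda>z. (d0 z, d1 z)) D ?K"
      using small_pairs[of "Field (Tob M R)" "Field (Tob M R)" ?K] T_ob[OF *(3)] by (auto simp: ob_Pos)
    have dz: "d0 z \<in> Field (Tob M R)" "d1 z \<in> Field (Tob M R)" "ext R X r1 (d0 z) = ext R X r0 (d1 z)"
      if "z \<in> D" for z using bij_betw_apply[OF bij that] by auto
    define RR where "RR = Id_on D"
    have RR: "RR \<in> Ps" "Field RR = D" "discrete RR" using Id_on_ob[OF D(1)] by (auto simp: RR_def)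
    have d: "mono_map RR (Tob M R) d0" "mono_map RR (Tob M R) d1"
      using dz D(2,3) by (auto intro!: mono_map_discrete[OF RR(3) T_ob[OF *(3)]] simp: RR(2))
    have "\<exists>u\<in>arr Kl W RR. cmp Kl W RR R d0 u = f \<and> cmp Kl W RR R d1 u = g"
      if W: "W \<in> ob Kl" and f: "f \<in> arr Kl W R" and g: "g \<in> arr Kl W R"
        and eq: "cmp Kl W R X r1 f = cmp Kl W R X r0 g" for W f g
    proof -
      have fg: "mono_map W (Tob M R) f" "mono_map W (Tob M R) g" using f g *(3) by (auto simp: Kl_arr)
      have "\<exists>z\<in>D. d0 z = f w \<and> d1 z = g w" if w: "w \<in> Field W" for w
      proof -
        have "(f w, g w) \<in> ?K"
          using mono_map_in[OF fg(1) w] mono_map_in[OF fg(2) w] w eq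
          by (auto simp: Kl_cmp compose_eq_iff)
        then have "(f w, g w) \<in> (\<lambda>z. (d0 z, d1 z)) ` D" using bij by (simp add: bij_betw_def)
        then show ?thesis by auto
      qed
      then obtain v where v: "mono_map W RR v" "\<And>w. w \<in> Field W \<Longrightarrow> d0 (v w) = f w \<and> d1 (v w) = g w"
        using discrete_choice[of W small RR "\<lambda>w z. d0 z = f w \<and> d1 z = g w"] W RR unfolding Kl_ob
        by blast
      \<comment> \<open>Composing with the unit makes \<open>v\<close> a Kleisli arrow with values
        among the generators, where the extensions of \<open>d0\<close> and \<open>d1\<close> reduce
        to \<open>d0\<close> and \<open>d1\<close>.\<close>
      define u where "u = compose (Field W) (eta M RR) v"
      have u: "mono_map W (Tob M RR) u"
        unfolding u_def using v(1) eta_mono_map[OF RR(1)] by (rule mono_map_compose)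
      have "ext RR R d0 (u w) = f w" "ext RR R d1 (u w) = g w" if w: "w \<in> Field W" for w
        using v(2)[OF w] mono_map_in[OF v(1) w] w lift_eta[OF RR(1) alg_free[OF *(3)]] d
        by (simp_all add: u_def compose_eq)
      then have "cmp Kl W RR R d0 u = f" "cmp Kl W RR R d1 u = g" unfolding Kl_cmp
        using mono_map_eqI[OF mono_map_compose[OF u ext_mono_map[OF RR(1) *(3) d(1)]] fg(1)]
          mono_map_eqI[OF mono_map_compose[OF u ext_mono_map[OF RR(1) *(3) d(2)]] fg(2)]
        by (simp_all add: compose_eq)
      then show ?thesis using u RR(1) by (auto simp: Kl_arr)
    qed
    moreover have "cmp Kl RR R X r1 d0 = cmp Kl RR R X r0 d1"
      using dz by (simp add: Kl_cmp compose_eq_iff RR(2))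
    ultimately have wp: "weak_pullback Kl R R X r1 r0 RR d0 d1"
      using RR d *(3) by (simp add: weak_pullback_def Kl_ob Kl_arr)
    have "\<exists>z'\<in>Field (Tob M R). ext R X r0 z' = ext R X r0 (d0 z) \<and> ext R X r1 z' = ext R X r1 (d1 z)"
      if z: "z \<in> Field RR" for z
    proof -
      have z: "z \<in> D" using z by (simp add: RR(2))
      \<comment> \<open>The chain passes through the common value of
        \<open>ext R X r1 (d0 z)\<close> and \<open>ext R X r0 (d1 z)\<close>.\<close>
      have "(q (ext R X r0 (d0 z)), q (ext R X r1 (d1 z))) \<in> A"
        using legs(3)[OF dz(1)[OF z]] legs(3)[OF dz(2)[OF z]] dz(3)[OF z] Pos_trans[OF *(8)] by auto
      then show ?thesis
        using kernel[OF legs(1)[OF dz(1)[OF z]] legs(2)[OF dz(2)[OF z]]] by metis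
    qed
    then obtain \<tau> where \<tau>: "mono_map RR (Tob M R) \<tau>" "\<And>z. z \<in> Field RR \<Longrightarrow>
        ext R X r0 (\<tau> z) = ext R X r0 (d0 z) \<and> ext R X r1 (\<tau> z) = ext R X r1 (d1 z)"
      using discrete_choice[OF RR(1,3) T_ob[OF *(3)],
          of "\<lambda>z z'. ext R X r0 z' = ext R X r0 (d0 z) \<and> ext R X r1 z' = ext R X r1 (d1 z)"]
      by blast
    then have "\<tau> \<in> arr Kl RR R" "cmp Kl RR R X r0 \<tau> = cmp Kl RR R X r0 d0"
      "cmp Kl RR R X r1 \<tau> = cmp Kl RR R X r1 d1"
      using *(3) by (simp_all add: Kl_arr Kl_cmp compose_eq_iff)
    then show ?thesis using wp by blast
  qed
  ultimately show ?thesis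
    using *(1-6) unfolding pseudocongruence_def Let_def defs[symmetric]
    by (auto simp: Kl_ob Kl_arr)
qed

text \<open>The generators are the points of \<open>A\<close> without their order, and the relations
  are all pairs in the order kernel of the resulting \<open>q\<close>, again made discrete.\<close>

lemma presentation_of_algebra:
  assumes A: "alg A a"
  obtains P q where "presents P A a q"
proof -
  have AP: "A \<in> Ps" using A by (simp add: alg_def)
  define X where "X = Id_on (Field A)"
  have X: "X \<in> Ps" "Field X = Field A" "discrete X"
    using Id_on_ob[of "Field A"] AP by (auto simp: X_def ob_Pos)
  define i where "i = (\<lambda>x\<in>Field A. x)"
  have i: "mono_map X A i" by (rule mono_map_discrete[OF X(3) AP]) (auto simp: X(2) i_def)
  define q where "q = lift X A a i"
  have q: "alg_hom (Tob M X) (mu M X) A a q" unfolding q_def using X(1) A i by (rule lift_alg_hom)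
  have qm: "mono_map (Tob M X) A q" using q by (simp add: alg_hom_def)
  have "q (eta M X x) = x" if "x \<in> Field A" for x
    using lift_eta[OF X(1) A i] that by (simp add: q_def i_def X(2))
  then have surj: "q ` Field (Tob M X) = Field A"
    using mono_map_in[OF qm] mono_map_in[OF eta_mono_map[OF X(1)]] X(2) by (force simp: image_iff)
  let ?K = "{(s, t). s \<in> Field (Tob M X) \<and> t \<in> Field (Tob M X) \<and> (q s, q t) \<in> A}"
  obtain D r0 r1 where D: "small D" "r0 \<in> extensional D" "r1 \<in> extensional D"
    and bij: "bij_betw (\<lambda>z. (r0 z, r1 z)) D ?K"
    using small_pairs[of "Field (Tob M X)" "Field (Tob M X)" ?K] T_ob[OF X(1)] by (auto simp: ob_Pos)
  have rz: "r0 z \<in> Field (Tob M X)" "r1 z \<in> Field (Tob M X)" "(q (r0 z), q (r1 z)) \<in> A"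
    if "z \<in> D" for z using bij_betw_apply[OF bij that] by auto
  define R where "R = Id_on D"
  have R: "R \<in> Ps" "Field R = D" "discrete R" using Id_on_ob[OF D(1)] by (auto simp: R_def)
  have r: "mono_map R (Tob M X) r0" "mono_map R (Tob M X) r1"
    using rz D(2,3) by (auto intro!: mono_map_discrete[OF R(3) T_ob[OF X(1)]] simp: R(2))
  have "(q s, q t) \<in> A \<longleftrightarrow> (\<exists>z\<in>Field (Tob M R). ext R X r0 z = s \<and> ext R X r1 z = t)"
    if st: "s \<in> Field (Tob M X)" "t \<in> Field (Tob M X)" for s t
  proof
    assume "(q s, q t) \<in> A"
    then have "(s, t) \<in> (\<lambda>z. (r0 z, r1 z)) ` D" using bij st by (simp add: bij_betw_def)
    then obtain z where "z \<in> Field R" "r0 z = s" "r1 z = t" using R(2) by auto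
    then show "\<exists>z\<in>Field (Tob M R). ext R X r0 z = s \<and> ext R X r1 z = t"
      using lift_eta[OF R(1) alg_free[OF X(1)]] r mono_map_in[OF eta_mono_map[OF R(1)]] by metis
  next
    assume "\<exists>z\<in>Field (Tob M R). ext R X r0 z = s \<and> ext R X r1 z = t"
    then obtain z where z: "z \<in> Field (Tob M R)" "ext R X r0 z = s" "ext R X r1 z = t" by blast
    \<comment> \<open>\<open>z\<close> need not be a generator of \<open>T R\<close>. The inequality
      holds at generators by the choice of \<open>R\<close>, and \<open>lift_le\<close> extends
      it.\<close>
    have "(lift R A a (compose (Field R) q r0) z, lift R A a (compose (Field R) q r1) z) \<in> A"
      using rz by (intro lift_le[OF R(1) A] mono_map_compose[OF r(1) qm] mono_map_compose[OF r(2) qm] z(1))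
        (simp add: compose_eq R(2))
    then show "(q s, q t) \<in> A"
      using alg_hom_lift[OF R(1) alg_free[OF X(1)] A q r(1) z(1)]
        alg_hom_lift[OF R(1) alg_free[OF X(1)] A q r(2) z(1)] z(2,3) by simp
  qed
  then have "presents \<lparr>base = X, rel = R, leg0 = r0, leg1 = r1\<rparr> A a q"
    using X R r A q surj by (simp add: presents_def Kl_ob Kl_arr)
  then show thesis by (rule that)
qed

end

context pos_monad_congruence
begin

text \<open>The structure map must satisfy \<open>a\<close> after \<open>T q\<close> equal to
  \<open>q\<close> after \<open>mu\<close>. It exists because \<open>T q\<close> is the coinserter
  of the projections from \<open>T S\<close>, where \<open>S\<close> is the order kernel of
  \<open>q\<close>; the work is to relate \<open>S\<close> to the given \<open>R\<close>.\<close>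

lemma presentation_of_pseudocongruence:
  assumes P: "pseudocongruence Kl P"
  obtains A a q where "presents P A a q"
proof -
  define X R r0 r1 where defs: "X = base P" "R = rel P" "r0 = leg0 P" "r1 = leg1 P"
  have ob: "X \<in> ob Kl" "R \<in> ob Kl" and arr: "r0 \<in> arr Kl R X" "r1 \<in> arr Kl R X"
    and le: "\<And>W f g. \<lbrakk>W \<in> ob Kl; (f, g) \<in> hom Kl W X\<rbrakk> \<Longrightarrow>
      \<exists>u\<in>arr Kl W R. cmp Kl W R X r0 u = f \<and> cmp Kl W R X r1 u = g"
    and "\<exists>RR d0 d1. weak_pullback Kl R R X r1 r0 RR d0 d1 \<and>
      (\<exists>\<tau>\<in>arr Kl RR R. cmp Kl RR R X r0 \<tau> = cmp Kl RR R X r0 d0 \<and>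
                        cmp Kl RR R X r1 \<tau> = cmp Kl RR R X r1 d1)"
    using P unfolding pseudocongruence_def Let_def defs by auto
  then obtain RR d0 d1 \<tau> where wp: "weak_pullback Kl R R X r1 r0 RR d0 d1" and \<tau>: "\<tau> \<in> arr Kl RR R"
    "cmp Kl RR R X r0 \<tau> = cmp Kl RR R X r0 d0" "cmp Kl RR R X r1 \<tau> = cmp Kl RR R X r1 d1" by blast
  have X: "X \<in> Ps" "R \<in> Ps" and r: "mono_map R (Tob M X) r0" "mono_map R (Tob M X) r1"
    using ob arr by (auto simp: Kl_ob Kl_arr)
  have RR: "RR \<in> Ps" and d: "d0 \<in> arr Kl RR R" "d1 \<in> arr Kl RR R"
    using wp by (auto simp: weak_pullback_def Kl_ob)
  let ?e0 = "ext R X r0" and ?e1 = "ext R X r1"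
  note e_hom = lift_alg_hom[OF X(2) alg_free[OF X(1)] r(1)] lift_alg_hom[OF X(2) alg_free[OF X(1)] r(2)]
  note e_mono = ext_mono_map[OF X(2,1) r(1)] ext_mono_map[OF X(2,1) r(2)]
  define K where "K = {(?e0 z, ?e1 z) | z. z \<in> Field (Tob M R)}"
  \<comment> \<open>The singleton is small as a subset of the carrier of \<open>Y\<close>. Kleisli
    arrows out of it pick out elements of free algebras.\<close>
  have point: "Id_on {x} \<in> ob Kl \<and> Field (Id_on {x}) = {x}" if "x \<in> Field Y" "Y \<in> Ps" for x Y
    using that Id_on_ob[of "{x}"] small_subset[of "Field Y" "{x}"] by (auto simp: ob_Pos Kl_ob)
  have point_map: "mono_map (Id_on {x}) Y (\<lambda>_\<in>{x}. y)" if "y \<in> Field Y" "Y \<in> Ps" for x y Y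
    using that by (auto intro!: mono_mapI Pos_refl simp: Field_def)
  have "K \<subseteq> Field (Tob M X) \<times> Field (Tob M X)"
    using mono_map_in[OF e_mono(1)] mono_map_in[OF e_mono(2)] by (auto simp: K_def)
  moreover have "Tob M X \<subseteq> K"
  proof clarify
    fix s t assume st: "(s, t) \<in> Tob M X"
    let ?W = "Id_on {s}"
    have F: "s \<in> Field (Tob M X)" "t \<in> Field (Tob M X)" using Pos_Field[OF st] by auto
    have W: "?W \<in> ob Kl" "Field ?W = {s}" using point[OF F(1)] X by auto
    have "((\<lambda>_\<in>{s}. s), (\<lambda>_\<in>{s}. t)) \<in> hom Kl ?W X"
      using point_map F X st W(2) by (simp add: Kl_hom)
    from le[OF W(1) this] obtain u where u: "u \<in> arr Kl ?W R"
      "cmp Kl ?W R X r0 u = (\<lambda>_\<in>{s}. s)" "cmp Kl ?W R X r1 u = (\<lambda>_\<in>{s}. t)" by blast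
    have "?e0 (u s) = s" "?e1 (u s) = t"
      using fun_cong[OF u(2), of s] fun_cong[OF u(3), of s] W(2) by (simp_all add: Kl_cmp compose_eq)
    moreover have "u s \<in> Field (Tob M R)"
      using u(1) W(2) X(2) by (auto simp: Kl_arr intro: mono_map_in)
    ultimately show "(s, t) \<in> K" unfolding K_def by force
  qed
  moreover have "trans K"
  proof (rule transI)
    fix s t w assume "(s, t) \<in> K" "(t, w) \<in> K"
    then obtain z z' where z: "z \<in> Field (Tob M R)" "z' \<in> Field (Tob M R)" "?e1 z = ?e0 z'"
      "s = ?e0 z" "w = ?e1 z'" by (auto simp: K_def)
    let ?W = "Id_on {z}"
    have W: "?W \<in> ob Kl" "Field ?W = {z}" using point[OF z(1)] X by auto
    have "(\<lambda>_\<in>{z}. z) \<in> arr Kl ?W R" "(\<lambda>_\<in>{z}. z') \<in> arr Kl ?W R"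
      using point_map z X by (auto simp: Kl_arr)
    moreover have "cmp Kl ?W R X r1 (\<lambda>_\<in>{z}. z) = cmp Kl ?W R X r0 (\<lambda>_\<in>{z}. z')"
      using z(3) W(2) by (simp add: Kl_cmp compose_eq_iff)
    ultimately obtain u where u: "u \<in> arr Kl ?W RR"
      "cmp Kl ?W RR R d0 u = (\<lambda>_\<in>{z}. z)" "cmp Kl ?W RR R d1 u = (\<lambda>_\<in>{z}. z')"
      using wp W(1) unfolding weak_pullback_def by blast
    define v where "v = u z"
    have v: "v \<in> Field (Tob M RR)" using u(1) W(2) RR by (auto simp: Kl_arr v_def intro: mono_map_in)
    have dv: "ext RR R d0 v = z" "ext RR R d1 v = z'"
      using fun_cong[OF u(2), of z] fun_cong[OF u(3), of z] W(2)
      by (simp_all add: Kl_cmp compose_eq v_def)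
    \<comment> \<open>The point \<open>v\<close> of \<open>T RR\<close> need not be a generator, so
      the equations between Kleisli arrows for \<open>\<tau>\<close> are first extended to all of
      \<open>T RR\<close>.\<close>
    have cmp0: "?e0 (ext RR R g v) = ext RR X (cmp Kl RR R X r0 g) v"
      and cmp1: "?e1 (ext RR R g v) = ext RR X (cmp Kl RR R X r1 g) v" if "g \<in> arr Kl RR R" for g
      using alg_hom_lift[OF RR alg_free alg_free _ _ v] e_hom X that by (auto simp: Kl_cmp Kl_arr)
    have "?e0 (ext RR R \<tau> v) = s" "?e1 (ext RR R \<tau> v) = w"
      using cmp0[OF \<tau>(1)] cmp0[OF d(1)] cmp1[OF \<tau>(1)] cmp1[OF d(2)] \<tau>(2,3) dv z(4,5) by auto
    moreover have "ext RR R \<tau> v \<in> Field (Tob M R)"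
      using \<tau>(1) X(2) by (auto simp: Kl_arr intro: mono_map_in[OF ext_mono_map[OF RR X(2)] v])
    ultimately show "(s, w) \<in> K" unfolding K_def by force
  qed
  ultimately obtain A q where A: "A \<in> Ps" and q: "mono_map (Tob M X) A q"
    and surj: "q ` Field (Tob M X) = Field A"
    and iff: "\<And>s t. \<lbrakk>s \<in> Field (Tob M X); t \<in> Field (Tob M X)\<rbrakk> \<Longrightarrow> (q s, q t) \<in> A \<longleftrightarrow> (s, t) \<in> K"
    using quotient_exists[OF T_ob[OF X(1)]] by metis
  note TX = T_ob[OF X(1)]
  obtain S k0 k1 where S: "kernel_pair (Tob M X) A q S k0 k1" using kernel_pair_exists[OF TX] .
  note SD = kernel_pairD[OF S]
  have e_in: "?e0 z \<in> Field (Tob M X)" "?e1 z \<in> Field (Tob M X)" "(q (?e0 z), q (?e1 z)) \<in> A"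
    if "z \<in> Field (Tob M R)" for z
    using mono_map_in[OF e_mono(1) that] mono_map_in[OF e_mono(2) that] iff that
    by (auto simp: K_def)
  have "\<forall>z\<in>Field (Tob M R). \<exists>\<zeta>. \<zeta> \<in> Field S \<and> k0 \<zeta> = ?e0 z \<and> k1 \<zeta> = ?e1 z"
    using SD(5) e_in by blast
  then obtain p' where p': "\<And>z. z \<in> Field (Tob M R) \<Longrightarrow> p' z \<in> Field S \<and> k0 (p' z) = ?e0 z \<and> k1 (p' z) = ?e1 z"
    by metis
  \<comment> \<open>This is the cover of the congruence by \<open>T R\<close>: the pairing of the
    two extended legs, with values in the copy \<open>S\<close>.\<close>
  define p where "p = (\<lambda>z\<in>Field (Tob M R). p' z)"
  have p: "p z \<in> Field S" "k0 (p z) = ?e0 z" "k1 (p z) = ?e1 z" if "z \<in> Field (Tob M R)" for z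
    using p'[OF that] that by (auto simp: p_def)
  have p_mono: "mono_map (Tob M R) S p"
  proof (rule mono_mapI)
    fix z w assume zw: "(z, w) \<in> Tob M R"
    then show "(p z, p w) \<in> S"
      using Pos_Field[OF zw] p mono_map_le[OF e_mono(1) zw] mono_map_le[OF e_mono(2) zw]
      by (intro SD(6)) auto
  qed (use p in \<open>auto simp: p_def\<close>)
  have p_surj: "p ` Field (Tob M R) = Field S"
  proof (intro equalityI subsetI)
    fix \<zeta> assume \<zeta>: "\<zeta> \<in> Field S"
    have k: "k0 \<zeta> \<in> Field (Tob M X)" "k1 \<zeta> \<in> Field (Tob M X)"
      using mono_map_in[OF SD(2) \<zeta>] mono_map_in[OF SD(3) \<zeta>] by auto
    then obtain z where z: "z \<in> Field (Tob M R)" "k0 \<zeta> = ?e0 z" "k1 \<zeta> = ?e1 z"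
      using iff[OF k] SD(4)[OF \<zeta>] by (auto simp: K_def)
    then have "\<zeta> = p z" using SD(5)[OF k SD(4)[OF \<zeta>]] \<zeta> p[OF z(1)] by metis
    then show "\<zeta> \<in> p ` Field (Tob M R)" using z(1) by blast
  qed (use p in auto)
  have k_p: "compose (Field (Tob M R)) k0 p = ?e0" "compose (Field (Tob M R)) k1 p = ?e1"
    using mono_map_eqI[OF mono_map_compose[OF p_mono SD(2)] e_mono(1)]
      mono_map_eqI[OF mono_map_compose[OF p_mono SD(3)] e_mono(2)] p by (simp_all add: compose_eq)
  note TR = T_ob[OF X(2)]
  note mu = mu_mono_map[OF X(1)]
  define h where "h = compose (Field (Tob M (Tob M X))) q (mu M X)"
  have h: "mono_map (Tob M (Tob M X)) A h" unfolding h_def using mu q by (rule mono_map_compose)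
  have h_app: "h w = q (mu M X w)" if "w \<in> Field (Tob M (Tob M X))" for w
    using that by (simp add: h_def compose_eq)
  \<comment> \<open>Along the surjection \<open>T p\<close> the point \<zeta> comes from some
    \<open>w\<close> in \<open>T (T R)\<close>. The extended legs are algebra maps, so applying
    \<open>mu\<close> yields the pair indexed by \<open>mu M R w\<close>, which lies in
    \<open>K\<close>.\<close>
  have "(h (Tmap M S (Tob M X) k0 \<zeta>), h (Tmap M S (Tob M X) k1 \<zeta>)) \<in> A"
    if \<zeta>: "\<zeta> \<in> Field (Tob M S)" for \<zeta>
  proof -
    obtain w where w: "w \<in> Field (Tob M (Tob M R))" "\<zeta> = Tmap M (Tob M R) S p w"
      using T_surj[OF TR SD(1) p_mono p_surj] \<zeta> by blast
    have "Tmap M S (Tob M X) k0 \<zeta> = Tmap M (Tob M R) (Tob M X) ?e0 w"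
      "Tmap M S (Tob M X) k1 \<zeta> = Tmap M (Tob M R) (Tob M X) ?e1 w"
      using Tmap_compose[OF TR SD(1) TX p_mono SD(2) w(1)]
        Tmap_compose[OF TR SD(1) TX p_mono SD(3) w(1)] by (simp_all add: k_p w(2))
    moreover have "mu M X (Tmap M (Tob M R) (Tob M X) ?e0 w) = ?e0 (mu M R w)"
      "mu M X (Tmap M (Tob M R) (Tob M X) ?e1 w) = ?e1 (mu M R w)"
      using e_hom w(1) by (simp_all add: alg_hom_def)
    ultimately show ?thesis
      using e_in(3)[OF mono_map_in[OF mu_mono_map[OF X(2)] w(1)]]
        mono_map_in[OF Tmap_mono_map[OF SD(1) TX SD(2)] \<zeta>]
        mono_map_in[OF Tmap_mono_map[OF SD(1) TX SD(3)] \<zeta>] by (simp add: h_app)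
  qed
  from T_factor[OF TX A q surj S A h this]
  obtain a where a: "mono_map (Tob M A) A a"
    and a_Tq: "\<And>w. w \<in> Field (Tob M (Tob M X)) \<Longrightarrow> a (Tmap M (Tob M X) A q w) = h w" by blast
  note Tq = Tmap_mono_map[OF TX A q]
  have "a (eta M A x) = x" if x: "x \<in> Field A" for x
  proof -
    obtain s where s: "s \<in> Field (Tob M X)" "x = q s" using surj x by blast
    have "a (eta M A x) = a (Tmap M (Tob M X) A q (eta M (Tob M X) s))"
      using eta_natural[OF TX A q s(1)] s(2) by simp
    then show ?thesis
      using a_Tq h_app mono_map_in[OF eta_mono_map[OF TX] s(1)] mu_eta_app[OF X(1) s(1)] s(2) by simp
  qed
  \<comment> \<open>The law is checked after the surjection \<open>T (T q)\<close>, where it reduces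
    to associativity of \<open>mu\<close> on \<open>X\<close>.\<close>
  moreover have "a (mu M A w) = a (Tmap M (Tob M A) A a w)" if w: "w \<in> Field (Tob M (Tob M A))" for w
  proof -
    obtain v where v: "v \<in> Field (Tob M (Tob M (Tob M X)))"
      "w = Tmap M (Tob M (Tob M X)) (Tob M A) (Tmap M (Tob M X) A q) v"
      using T_surj[OF T_ob[OF TX] T_ob[OF A] Tq T_surj[OF TX A q surj]] w by blast
    have Tmu: "Tmap M (Tob M (Tob M X)) (Tob M X) (mu M X) v \<in> Field (Tob M (Tob M X))"
      using mono_map_in[OF Tmap_mono_map[OF T_ob[OF TX] TX mu] v(1)] .
    have h_eq: "h = compose (Field (Tob M (Tob M X))) a (Tmap M (Tob M X) A q)"
      using mono_map_eqI[OF h mono_map_compose[OF Tq a]] a_Tq by (simp add: compose_eq)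
    have "a (mu M A w) = h (mu M (Tob M X) v)"
      using mu_natural[OF TX A q v(1)] v(2) a_Tq mono_map_in[OF mu_mono_map[OF TX] v(1)] by simp
    also have "\<dots> = q (mu M X (Tmap M (Tob M (Tob M X)) (Tob M X) (mu M X) v))"
      using h_app mono_map_in[OF mu_mono_map[OF TX] v(1)] mu_mu_app[OF X(1) v(1)] by simp
    also have "\<dots> = a (Tmap M (Tob M X) A q (Tmap M (Tob M (Tob M X)) (Tob M X) (mu M X) v))"
      using a_Tq h_app Tmu by simp
    also have "\<dots> = a (Tmap M (Tob M (Tob M X)) A h v)"
      unfolding h_def using Tmap_compose[OF T_ob[OF TX] TX A mu q v(1)] by simp
    also have "\<dots> = a (Tmap M (Tob M A) A a w)"
      unfolding h_eq v(2) using Tmap_compose[OF T_ob[OF TX] T_ob[OF A] A Tq a v(1)] by simp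
    finally show ?thesis .
  qed
  ultimately have alg: "alg A a" using A a by (simp add: alg_def)
  have "alg_hom (Tob M X) (mu M X) A a q"
    using q a_Tq h_app by (simp add: alg_hom_def)
  moreover have "(q s, q t) \<in> A \<longleftrightarrow> (\<exists>z\<in>Field (Tob M R). ?e0 z = s \<and> ?e1 z = t)"
    if "s \<in> Field (Tob M X)" "t \<in> Field (Tob M X)" for s t
    using iff[OF that] unfolding K_def by auto
  ultimately have "presents P A a q"
    using ob arr alg surj unfolding presents_def defs[symmetric] by auto
  then show thesis by (rule that)
qed

section \<open>Morphisms between presented algebras\<close>

text \<open>Taking all representatives of \<open>f\<close> at once gives the action on arrows
  without choosing any of them.\<close>

definition lifts :: "('a rel, 'a \<Rightarrow> 'a) ppair \<Rightarrow> ('a \<Rightarrow> 'a) \<Rightarrow> ('a rel, 'a \<Rightarrow> 'a) ppair \<Rightarrow> ('a \<Rightarrow> 'a) \<Rightarrow>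
    ('a \<Rightarrow> 'a) \<Rightarrow> ('a \<Rightarrow> 'a) set" where
  "lifts P q P' q' f = {\<phi>. mono_map (base P) (Tob M (base P')) \<phi> \<and>
     (\<forall>x\<in>Field (base P). q' (\<phi> x) = f (q (eta M (base P) x)))}"

lemma presents_ext:
  assumes "presents P A a q" "presents P' A' a' q'" "mono_map (base P) (Tob M (base P')) \<phi>"
    and s: "s \<in> Field (Tob M (base P))"
  shows "q' (ext (base P) (base P') \<phi> s)
    = lift (base P) A' a' (compose (Field (base P)) q' \<phi>) s"
  using presentsD[OF assms(1)] presentsD[OF assms(2)] assms(3,4)
  by (intro alg_hom_lift) (auto intro: alg_free)

text \<open>The defining equation concerns generators; both sides extend to algebra maps out of the
  free algebra, which are then equal.\<close>

lemma lifts_ext: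
  assumes P: "presents P A a q" and P': "presents P' A' a' q'" and f: "alg_hom A a A' a' f"
    and \<phi>: "\<phi> \<in> lifts P q P' q' f" and s: "s \<in> Field (Tob M (base P))"
  shows "q' (ext (base P) (base P') \<phi> s) = f (q s)"
proof -
  note D = presentsD[OF P] and D' = presentsD[OF P']
  have \<phi>m: "mono_map (base P) (Tob M (base P')) \<phi>"
    "\<And>x. x \<in> Field (base P) \<Longrightarrow> q' (\<phi> x) = f (q (eta M (base P) x))"
    using \<phi> by (auto simp: lifts_def)
  let ?h = "compose (Field (Tob M (base P))) f q"
  have "alg_hom (Tob M (base P)) (mu M (base P)) A' a' ?h"
    using alg_hom_compose[OF alg_free[OF D(1)] D(7) D'(7) D(9) f] .
  from lift_unique[OF D(1) D'(7) this _ mono_map_compose[OF \<phi>m(1) D'(10)] s]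
  show ?thesis
    using presents_ext[OF P P' \<phi>m(1) s] \<phi>m(2) s mono_map_in[OF eta_mono_map[OF D(1)]]
    by (simp add: compose_eq)
qed

text \<open>Every point of \<open>A\<close> is \<open>q s\<close> for some \<open>s\<close>, and
  \<open>lift_le\<close> carries the inequality from generators to \<open>s\<close>.\<close>

lemma lifts_le_iff:
  assumes P: "presents P A a q" and P': "presents P' A' a' q'"
    and f: "alg_hom A a A' a' f" and g: "alg_hom A a A' a' g"
    and \<phi>: "\<phi> \<in> lifts P q P' q' f" and \<psi>: "\<psi> \<in> lifts P q P' q' g"
  shows "(\<forall>y\<in>Field A. (f y, g y) \<in> A') \<longleftrightarrow> (\<forall>x\<in>Field (base P). (q' (\<phi> x), q' (\<psi> x)) \<in> A')"
proof
  note D = presentsD[OF P] and D' = presentsD[OF P']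
  assume "\<forall>y\<in>Field A. (f y, g y) \<in> A'"
  then show "\<forall>x\<in>Field (base P). (q' (\<phi> x), q' (\<psi> x)) \<in> A'"
    using \<phi> \<psi> mono_map_in[OF D(10)] mono_map_in[OF eta_mono_map[OF D(1)]] by (auto simp: lifts_def)
next
  note D = presentsD[OF P] and D' = presentsD[OF P']
  assume le: "\<forall>x\<in>Field (base P). (q' (\<phi> x), q' (\<psi> x)) \<in> A'"
  show "\<forall>y\<in>Field A. (f y, g y) \<in> A'"
  proof
    fix y assume "y \<in> Field A"
    then obtain s where s: "s \<in> Field (Tob M (base P))" "y = q s" using D(11) by blast
    have m: "mono_map (base P) (Tob M (base P')) \<phi>" "mono_map (base P) (Tob M (base P')) \<psi>"
      using \<phi> \<psi> by (auto simp: lifts_def)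
    have "(q' (ext (base P) (base P') \<phi> s), q' (ext (base P) (base P') \<psi> s)) \<in> A'"
      unfolding presents_ext[OF P P' m(1) s(1)] presents_ext[OF P P' m(2) s(1)]
      using le by (intro lift_le[OF D(1) D'(7)] mono_map_compose[OF _ D'(10)] m s(1)) (simp add: compose_eq)
    then show "(f y, g y) \<in> A'"
      using lifts_ext[OF P P' f \<phi> s(1)] lifts_ext[OF P P' g \<psi> s(1)] s(2) by simp
  qed
qed

lemma lifts_inj:
  assumes P: "presents P A a q" and P': "presents P' A' a' q'"
    and f: "alg_hom A a A' a' f" and g: "alg_hom A a A' a' g"
    and \<phi>: "\<phi> \<in> lifts P q P' q' f" "\<phi> \<in> lifts P q P' q' g"
  shows "f = g"
proof (rule mono_map_eqI)
  fix y assume "y \<in> Field A"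
  then obtain s where s: "s \<in> Field (Tob M (base P))" "y = q s" using presentsD(11)[OF P] by blast
  then show "f y = g y" using lifts_ext[OF P P' f \<phi>(1)] lifts_ext[OF P P' g \<phi>(2)] by simp
qed (use f g in \<open>auto simp: alg_hom_def\<close>)

text \<open>Preimages under the surjection \<open>q'\<close> are chosen independently at each point
  of the discrete base.\<close>

lemma lifts_nonempty:
  assumes P: "presents P A a q" and P': "presents P' A' a' q'" and f: "alg_hom A a A' a' f"
  obtains \<phi> where "\<phi> \<in> lifts P q P' q' f"
proof -
  note D = presentsD[OF P] and D' = presentsD[OF P']
  have "\<exists>t\<in>Field (Tob M (base P')). q' t = f (q (eta M (base P) x))" if "x \<in> Field (base P)" for x
  proof -
    have "f (q (eta M (base P) x)) \<in> Field A'"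
      using f mono_map_in[OF D(10)] mono_map_in[OF eta_mono_map[OF D(1)] that]
      by (auto simp: alg_hom_def mono_map_in)
    then show ?thesis using D'(11) by (metis imageE)
  qed
  then obtain \<phi> where "mono_map (base P) (Tob M (base P')) \<phi>"
    "\<And>x. x \<in> Field (base P) \<Longrightarrow> q' (\<phi> x) = f (q (eta M (base P) x))"
    using discrete_choice[OF D(1,2) T_ob[OF D'(1)], of "\<lambda>x t. q' t = f (q (eta M (base P) x))"]
    by blast
  then show thesis by (intro that[of \<phi>]) (simp add: lifts_def)
qed

text \<open>Compatibility with the relations makes the extension of \<phi> send the order kernel of
  \<open>q\<close> into that of \<open>q'\<close>, which is what factoring through \<open>q\<close>
  requires. Conversely, monotonicity of \<open>f\<close> keeps related generators related, and
  \<open>T R'\<close> covers the resulting pairs.\<close>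

lemma ppair_maps_iff:
  assumes P: "presents P A a q" and P': "presents P' A' a' q'"
  shows "\<phi> \<in> ppair_maps Kl P P' \<longleftrightarrow> (\<exists>f. alg_hom A a A' a' f \<and> \<phi> \<in> lifts P q P' q' f)"
proof
  note D = presentsD[OF P] and D' = presentsD[OF P']
  let ?e0 = "ext (rel P) (base P) (leg0 P)" and ?e1 = "ext (rel P) (base P) (leg1 P)"
  let ?e0' = "ext (rel P') (base P') (leg0 P')" and ?e1' = "ext (rel P') (base P') (leg1 P')"
  {
    assume "\<phi> \<in> ppair_maps Kl P P'"
    then obtain h where \<phi>: "mono_map (base P) (Tob M (base P')) \<phi>"
      and h: "mono_map (rel P) (Tob M (rel P')) h"
      and eq: "compose (Field (rel P)) ?e0' h = compose (Field (rel P)) (ext (base P) (base P') \<phi>) (leg0 P)"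
        "compose (Field (rel P)) ?e1' h = compose (Field (rel P)) (ext (base P) (base P') \<phi>) (leg1 P)"
      using D(1) D'(1,3) by (auto simp: ppair_maps_def Kl_arr Kl_cmp)
    let ?\<phi> = "ext (base P) (base P') \<phi>"
    have \<phi>_hom: "alg_hom (Tob M (base P)) (mu M (base P)) (Tob M (base P')) (mu M (base P')) ?\<phi>"
      using D(1) alg_free[OF D'(1)] \<phi> by (rule lift_alg_hom)
    define \<psi> where "\<psi> = compose (Field (Tob M (base P))) q' ?\<phi>"
    have \<psi>_hom: "alg_hom (Tob M (base P)) (mu M (base P)) A' a' \<psi>"
      unfolding \<psi>_def using alg_free[OF D(1)] alg_free[OF D'(1)] D'(7) \<phi>_hom D'(9)
      by (rule alg_hom_compose)
    have \<psi>: "mono_map (Tob M (base P)) A' \<psi>" using \<psi>_hom by (simp add: alg_hom_def)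
    have le: "(\<psi> s, \<psi> t) \<in> A'"
      if st: "s \<in> Field (Tob M (base P))" "t \<in> Field (Tob M (base P))" "(q s, q t) \<in> A" for s t
    proof -
      obtain z where z: "z \<in> Field (Tob M (rel P))" "?e0 z = s" "?e1 z = t"
        using presents_kernel[OF P st] .
      let ?w = "ext (rel P) (rel P') h z"
      \<comment> \<open>The square for \<open>h\<close> is an equation of Kleisli arrows; extending
        both sides gives it at every point of \<open>T R\<close>.\<close>
      have "?\<phi> (?e0 z) = ?e0' ?w"
        using alg_hom_lift[OF D(3) alg_free[OF D(1)] alg_free[OF D'(1)] \<phi>_hom D(5) z(1)]
          alg_hom_lift[OF D(3) alg_free[OF D'(3)] alg_free[OF D'(1)]
            lift_alg_hom[OF D'(3) alg_free[OF D'(1)] D'(5)] h z(1)] eq(1) by simp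
      moreover have "?\<phi> (?e1 z) = ?e1' ?w"
        using alg_hom_lift[OF D(3) alg_free[OF D(1)] alg_free[OF D'(1)] \<phi>_hom D(6) z(1)]
          alg_hom_lift[OF D(3) alg_free[OF D'(3)] alg_free[OF D'(1)]
            lift_alg_hom[OF D'(3) alg_free[OF D'(1)] D'(6)] h z(1)] eq(2) by simp
      ultimately show ?thesis
        using presents_legs(3)[OF P' mono_map_in[OF ext_mono_map[OF D(3) D'(3) h] z(1)]] st z(2,3)
        by (simp add: \<psi>_def compose_eq)
    qed
    define f where "f = (\<lambda>y\<in>Field A. \<psi> (inv_into (Field (Tob M (base P))) q y))"
    have inv: "inv_into (Field (Tob M (base P))) q y \<in> Field (Tob M (base P))"
      "q (inv_into (Field (Tob M (base P))) q y) = y" if "y \<in> Field A" for y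
      using that D(11) by (auto intro: inv_into_into f_inv_into_f)
    have f: "mono_map A A' f"
    proof (rule mono_mapI)
      fix x y assume xy: "(x, y) \<in> A"
      then show "(f x, f y) \<in> A'"
        using Pos_Field[OF xy] inv[of x] inv[of y] le by (simp add: f_def)
    qed (use inv mono_map_in[OF \<psi>] in \<open>auto simp: f_def\<close>)
    have fq: "f (q s) = \<psi> s" if s: "s \<in> Field (Tob M (base P))" for s
      using mono_map_in[OF D(10) s] inv[of "q s"] s Pos_refl[OF D(8), of "q s"]
      by (auto simp: f_def intro!: Pos_antisym[OF D'(8)] le)
    have \<psi>_eq: "\<psi> = compose (Field (Tob M (base P))) f q"
      using mono_map_eqI[OF \<psi> mono_map_compose[OF D(10) f]] fq by (simp add: compose_eq)
    note TX = T_ob[OF D(1)]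
    \<comment> \<open>Surjectivity of \<open>T q\<close> reduces this to the same equation for
      \<psi>, already an algebra map.\<close>
    have "f (a w) = a' (Tmap M A A' f w)" if w: "w \<in> Field (Tob M A)" for w
    proof -
      obtain v where v: "v \<in> Field (Tob M (Tob M (base P)))" "w = Tmap M (Tob M (base P)) A q v"
        using T_surj[OF TX D(8,10,11)] w by blast
      have "f (a w) = f (q (mu M (base P) v))" using D(9) v by (simp add: alg_hom_def)
      also have "\<dots> = \<psi> (mu M (base P) v)"
        by (rule fq[OF mono_map_in[OF mu_mono_map[OF D(1)] v(1)]])
      also have "\<dots> = a' (Tmap M (Tob M (base P)) A' \<psi> v)" using \<psi>_hom v(1) by (simp add: alg_hom_def)
      also have "\<dots> = a' (Tmap M A A' f w)"
        unfolding \<psi>_eq v(2) using Tmap_compose[OF TX D(8) D'(8) D(10) f v(1)] by simp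
      finally show ?thesis .
    qed
    then have "alg_hom A a A' a' f" using f by (simp add: alg_hom_def)
    moreover have "\<phi> \<in> lifts P q P' q' f"
      using \<phi> mono_map_in[OF eta_mono_map[OF D(1)]] lift_eta[OF D(1) alg_free[OF D'(1)] \<phi>]
      by (simp add: lifts_def fq \<psi>_def compose_eq)
    ultimately show "\<exists>f. alg_hom A a A' a' f \<and> \<phi> \<in> lifts P q P' q' f" by blast
  next
    assume "\<exists>f. alg_hom A a A' a' f \<and> \<phi> \<in> lifts P q P' q' f"
    then obtain f where f: "alg_hom A a A' a' f" and \<phi>: "\<phi> \<in> lifts P q P' q' f" by blast
    let ?\<phi> = "ext (base P) (base P') \<phi>"
    have \<phi>m: "mono_map (base P) (Tob M (base P')) \<phi>" using \<phi> by (simp add: lifts_def)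
    have "\<exists>w\<in>Field (Tob M (rel P')). ?e0' w = ?\<phi> (leg0 P z) \<and> ?e1' w = ?\<phi> (leg1 P z)"
      if z: "z \<in> Field (rel P)" for z
    proof -
      have l: "leg0 P z \<in> Field (Tob M (base P))" "leg1 P z \<in> Field (Tob M (base P))"
        using mono_map_in[OF D(5) z] mono_map_in[OF D(6) z] by auto
      have "(q (leg0 P z), q (leg1 P z)) \<in> A"
        using presents_legs(3)[OF P mono_map_in[OF eta_mono_map[OF D(3)] z]]
          lift_eta[OF D(3) alg_free[OF D(1)] D(5) z] lift_eta[OF D(3) alg_free[OF D(1)] D(6) z] by simp
      then have "(q' (?\<phi> (leg0 P z)), q' (?\<phi> (leg1 P z))) \<in> A'"
        using lifts_ext[OF P P' f \<phi> l(1)] lifts_ext[OF P P' f \<phi> l(2)] f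
        by (auto simp: alg_hom_def mono_map_le)
      then show ?thesis
        using presents_kernel[OF P' mono_map_in[OF ext_mono_map[OF D(1) D'(1) \<phi>m] l(1)]
            mono_map_in[OF ext_mono_map[OF D(1) D'(1) \<phi>m] l(2)]] by metis
    qed
    then obtain h where h: "mono_map (rel P) (Tob M (rel P')) h" "\<And>z. z \<in> Field (rel P) \<Longrightarrow>
        ?e0' (h z) = ?\<phi> (leg0 P z) \<and> ?e1' (h z) = ?\<phi> (leg1 P z)"
      using discrete_choice[OF D(3,4) T_ob[OF D'(3)],
          of "\<lambda>z w. ?e0' w = ?\<phi> (leg0 P z) \<and> ?e1' w = ?\<phi> (leg1 P z)"] by blast
    then have "h \<in> arr Kl (rel P) (rel P')" using D'(3) by (simp add: Kl_arr)
    then show "\<phi> \<in> ppair_maps Kl P P'"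
      using \<phi>m h(2) D'(1) unfolding ppair_maps_def Kl_cmp compose_eq_iff by (auto simp: Kl_arr)
  }
qed

text \<open>A witness \<Sigma> chooses, for each generator, a point of \<open>T R'\<close> over the
  pair of values. By the kernel clause such a point exists exactly when the images under
  \<open>q'\<close> are ordered.\<close>

lemma ppair_le_iff:
  assumes P: "presents P A a q" and P': "presents P' A' a' q'"
    and f: "alg_hom A a A' a' f" and g: "alg_hom A a A' a' g"
    and \<phi>: "\<phi> \<in> lifts P q P' q' f" and \<psi>: "\<psi> \<in> lifts P q P' q' g"
  shows "(\<phi>, \<psi>) \<in> ppair_le Kl P P' \<longleftrightarrow> (\<forall>y\<in>Field A. (f y, g y) \<in> A')"
proof -
  note D = presentsD[OF P] and D' = presentsD[OF P']
  let ?e0' = "ext (rel P') (base P') (leg0 P')" and ?e1' = "ext (rel P') (base P') (leg1 P')"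
  have m: "mono_map (base P) (Tob M (base P')) \<phi>" "mono_map (base P) (Tob M (base P')) \<psi>"
    using \<phi> \<psi> by (auto simp: lifts_def)
  have "(\<exists>\<Sigma>\<in>arr Kl (base P) (rel P'). cmp Kl (base P) (rel P') (base P') (leg0 P') \<Sigma> = \<phi> \<and>
        cmp Kl (base P) (rel P') (base P') (leg1 P') \<Sigma> = \<psi>)
      \<longleftrightarrow> (\<forall>x\<in>Field (base P). (q' (\<phi> x), q' (\<psi> x)) \<in> A')" (is "?L \<longleftrightarrow> ?R")
  proof
    assume ?L
    then obtain \<Sigma> where \<Sigma>: "mono_map (base P) (Tob M (rel P')) \<Sigma>"
      "compose (Field (base P)) ?e0' \<Sigma> = \<phi>" "compose (Field (base P)) ?e1' \<Sigma> = \<psi>"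
      using D'(3) by (auto simp: Kl_arr Kl_cmp)
    show ?R
    proof
      fix x assume x: "x \<in> Field (base P)"
      then have "\<phi> x = ?e0' (\<Sigma> x)" "\<psi> x = ?e1' (\<Sigma> x)"
        using fun_cong[OF \<Sigma>(2), of x] fun_cong[OF \<Sigma>(3), of x] by (simp_all add: compose_eq)
      then show "(q' (\<phi> x), q' (\<psi> x)) \<in> A'"
        using presents_legs(3)[OF P' mono_map_in[OF \<Sigma>(1) x]] by simp
    qed
  next
    assume ?R
    then have "\<exists>w\<in>Field (Tob M (rel P')). ?e0' w = \<phi> x \<and> ?e1' w = \<psi> x" if "x \<in> Field (base P)" for x
      using presents_kernel[OF P' mono_map_in[OF m(1) that] mono_map_in[OF m(2) that]] that by metis
    then obtain \<Sigma> where \<Sigma>: "mono_map (base P) (Tob M (rel P')) \<Sigma>"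
      "\<And>x. x \<in> Field (base P) \<Longrightarrow> ?e0' (\<Sigma> x) = \<phi> x \<and> ?e1' (\<Sigma> x) = \<psi> x"
      using discrete_choice[OF D(1,2) T_ob[OF D'(3)], of "\<lambda>x w. ?e0' w = \<phi> x \<and> ?e1' w = \<psi> x"] by blast
    have "compose (Field (base P)) ?e0' \<Sigma> = \<phi>" "compose (Field (base P)) ?e1' \<Sigma> = \<psi>"
      using mono_map_eqI[OF mono_map_compose[OF \<Sigma>(1) ext_mono_map[OF D'(3,1,5)]] m(1)]
        mono_map_eqI[OF mono_map_compose[OF \<Sigma>(1) ext_mono_map[OF D'(3,1,6)]] m(2)] \<Sigma>(2)
      by (simp_all add: compose_eq)
    then show ?L using \<Sigma>(1) D'(3) by (auto simp: Kl_arr Kl_cmp)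
  qed
  moreover have "\<phi> \<in> ppair_maps Kl P P'" "\<psi> \<in> ppair_maps Kl P P'"
    using ppair_maps_iff[OF P P'] f g \<phi> \<psi> by blast+
  ultimately show ?thesis using lifts_le_iff[OF assms] by (simp add: ppair_le_def)
qed

text \<open>Mutual comparability of representatives means that the represented algebra maps bound
  each other, hence coincide by antisymmetry in \<open>A'\<close>.\<close>

lemma ppair_class_eq:
  assumes P: "presents P A a q" and P': "presents P' A' a' q'"
    and f: "alg_hom A a A' a' f" and \<phi>: "\<phi> \<in> lifts P q P' q' f"
  shows "ppair_class Kl P P' \<phi> = lifts P q P' q' f"
proof (intro equalityI subsetI)
  fix \<psi> assume \<psi>: "\<psi> \<in> ppair_class Kl P P' \<phi>"
  then have "\<psi> \<in> ppair_maps Kl P P'" by (simp add: ppair_class_def ppair_le_def)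
  then obtain g where g: "alg_hom A a A' a' g" "\<psi> \<in> lifts P q P' q' g"
    using ppair_maps_iff[OF P P'] by blast
  have "\<forall>y\<in>Field A. (f y, g y) \<in> A'" "\<forall>y\<in>Field A. (g y, f y) \<in> A'"
    using \<psi> ppair_le_iff[OF P P' f g(1) \<phi> g(2)] ppair_le_iff[OF P P' g(1) f g(2) \<phi>]
    by (auto simp: ppair_class_def)
  then have "g y = f y" if "y \<in> Field A" for y
    using that by (auto intro: Pos_antisym[OF presentsD(8)[OF P']])
  then have "g = f" using f g(1) by (auto simp: alg_hom_def intro: mono_map_eqI)
  then show "\<psi> \<in> lifts P q P' q' f" using g(2) by simp
next
  fix \<psi> assume \<psi>: "\<psi> \<in> lifts P q P' q' f"
  have "\<forall>y\<in>Field A. (f y, f y) \<in> A'"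
    using f Pos_refl[OF presentsD(8)[OF P']] by (auto simp: alg_hom_def mono_map_in)
  then show "\<psi> \<in> ppair_class Kl P P' \<phi>"
    using ppair_le_iff[OF P P' f f \<phi> \<psi>] ppair_le_iff[OF P P' f f \<psi> \<phi>] by (simp add: ppair_class_def)
qed

lemma ex_hom_eq:
  assumes P: "presents P A a q" and P': "presents P' A' a' q'"
  shows "hom (ex_completion Kl) P P' = map_prod (lifts P q P' q') (lifts P q P' q') `
    hom (EM_category (Pos small) M) (A, a) (A', a')"
proof (intro equalityI subsetI)
  note alg = presentsD(7)[OF P] presentsD(7)[OF P']
  fix s assume "s \<in> hom (ex_completion Kl) P P'"
  then obtain \<phi> \<psi> where s: "s = (ppair_class Kl P P' \<phi>, ppair_class Kl P P' \<psi>)"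
    and le: "(\<phi>, \<psi>) \<in> ppair_le Kl P P'" by (auto simp: ex_completion_def)
  then have "\<phi> \<in> ppair_maps Kl P P'" "\<psi> \<in> ppair_maps Kl P P'" by (auto simp: ppair_le_def)
  then obtain f g where fg: "alg_hom A a A' a' f" "alg_hom A a A' a' g"
    "\<phi> \<in> lifts P q P' q' f" "\<psi> \<in> lifts P q P' q' g"
    using ppair_maps_iff[OF P P'] by blast
  then have "(f, g) \<in> hom (EM_category (Pos small) M) (A, a) (A', a')"
    using le ppair_le_iff[OF P P' fg] EM_hom[OF alg] by simp
  moreover have "s = map_prod (lifts P q P' q') (lifts P q P' q') (f, g)"
    using s ppair_class_eq[OF P P'] fg by simp
  ultimately show "s \<in> map_prod (lifts P q P' q') (lifts P q P' q') `
    hom (EM_category (Pos small) M) (A, a) (A', a')" by blast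
next
  note alg = presentsD(7)[OF P] presentsD(7)[OF P']
  fix s assume "s \<in> map_prod (lifts P q P' q') (lifts P q P' q') `
    hom (EM_category (Pos small) M) (A, a) (A', a')"
  then obtain f g where s: "s = (lifts P q P' q' f, lifts P q P' q' g)"
    and fg: "alg_hom A a A' a' f" "alg_hom A a A' a' g" "\<forall>y\<in>Field A. (f y, g y) \<in> A'"
    using EM_hom[OF alg] by auto
  obtain \<phi> \<psi> where l: "\<phi> \<in> lifts P q P' q' f" "\<psi> \<in> lifts P q P' q' g"
    using lifts_nonempty[OF P P' fg(1)] lifts_nonempty[OF P P' fg(2)] by metis
  then have "(\<phi>, \<psi>) \<in> ppair_le Kl P P'" using ppair_le_iff[OF P P' fg(1,2) l] fg(3) by simp
  moreover have "s = (ppair_class Kl P P' \<phi>, ppair_class Kl P P' \<psi>)"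
    using s ppair_class_eq[OF P P' fg(1) l(1)] ppair_class_eq[OF P P' fg(2) l(2)] by simp
  ultimately show "s \<in> hom (ex_completion Kl) P P'" by (auto simp: ex_completion_def)
qed

lemma ex_idn:
  assumes P: "presents P A a q"
  shows "lifts P q P q (\<lambda>x\<in>Field A. x) = idn (ex_completion Kl) P"
proof -
  note D = presentsD[OF P]
  have "eta M (base P) \<in> lifts P q P q (\<lambda>x\<in>Field A. x)"
    using eta_mono_map[OF D(1)] mono_map_in[OF D(10) mono_map_in[OF eta_mono_map[OF D(1)]]]
    by (simp add: lifts_def)
  from ppair_class_eq[OF P P alg_hom_id[OF D(7)] this] show ?thesis
    by (simp add: ex_completion_def Kl_idn)
qed

text \<open>Every pair of representatives contributes the same set to the union that defines
  composition, namely all lifts of the composite.\<close>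

lemma ex_cmp:
  assumes P: "presents P A a q" and P': "presents P' A' a' q'" and P'': "presents P'' A'' a'' q''"
    and f: "alg_hom A a A' a' f" and g: "alg_hom A' a' A'' a'' g"
  shows "lifts P q P'' q'' (compose (Field A) g f)
    = cmp (ex_completion Kl) P P' P'' (lifts P' q' P'' q'' g) (lifts P q P' q' f)"
proof -
  note D = presentsD[OF P] and D' = presentsD[OF P'] and D'' = presentsD[OF P'']
  have gf: "alg_hom A a A'' a'' (compose (Field A) g f)"
    using D(7) D'(7) D''(7) f g by (rule alg_hom_compose)
  have "ppair_class Kl P P'' (cmp Kl (base P) (base P') (base P'') \<psi> \<phi>)
      = lifts P q P'' q'' (compose (Field A) g f)"
    if \<phi>: "\<phi> \<in> lifts P q P' q' f" and \<psi>: "\<psi> \<in> lifts P' q' P'' q'' g" for \<phi> \<psi>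
  proof (rule ppair_class_eq[OF P P'' gf])
    have m: "mono_map (base P) (Tob M (base P')) \<phi>" "mono_map (base P') (Tob M (base P'')) \<psi>"
      "\<And>x. x \<in> Field (base P) \<Longrightarrow> q' (\<phi> x) = f (q (eta M (base P) x))"
      using \<phi> \<psi> by (auto simp: lifts_def)
    show "cmp Kl (base P) (base P') (base P'') \<psi> \<phi> \<in> lifts P q P'' q'' (compose (Field A) g f)"
      using mono_map_compose[OF m(1) ext_mono_map[OF D'(1) D''(1) m(2)]]
        lifts_ext[OF P' P'' g \<psi> mono_map_in[OF m(1)]] m(3)
        mono_map_in[OF D(10) mono_map_in[OF eta_mono_map[OF D(1)]]]
      by (simp add: lifts_def Kl_cmp compose_eq)
  qed
  \<comment> \<open>Without representatives the union would be empty.\<close>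
  moreover obtain \<phi> \<psi> where "\<phi> \<in> lifts P q P' q' f" "\<psi> \<in> lifts P' q' P'' q'' g"
    using lifts_nonempty[OF P P' f] lifts_nonempty[OF P' P'' g] by metis
  ultimately show ?thesis by (auto simp: ex_completion_def)
qed

text \<open>The apex holds every presentation, so both legs are onto by the two existence results,
  and \<Psi> is \<open>lifts\<close> for the presenting maps carried by the indices.\<close>

lemma EM_equivalent_ex: "pos_equivalent (EM_category (Pos small) M) (ex_completion Kl)"
proof -
  let ?E = "{(P, (A, a), q). presents P A a q}"
  have "pos_span (EM_category (Pos small) M) (ex_completion Kl) ?E (\<lambda>i. fst (snd i)) fst
    (\<lambda>i j. lifts (fst i) (snd (snd i)) (fst j) (snd (snd j)))"
  proof (intro pos_span.intro pos_span_axioms.intro pos_category_EM)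
    show "(\<lambda>i. fst (snd i)) ` ?E = ob (EM_category (Pos small) M)"
    proof (intro equalityI subsetI)
      fix p assume "p \<in> ob (EM_category (Pos small) M)"
      then obtain A a where p: "p = (A, a)" "alg A a" by (metis EM_ob surj_pair)
      obtain P q where "presents P A a q" using presentation_of_algebra[OF p(2)] .
      then have "(P, p, q) \<in> ?E" using p by simp
      then show "p \<in> (\<lambda>i. fst (snd i)) ` ?E" by (rule rev_image_eqI) simp
    qed (auto simp: EM_ob dest: presentsD(7))
    show "fst ` ?E = ob (ex_completion Kl)"
    proof (intro equalityI subsetI)
      fix P assume "P \<in> ob (ex_completion Kl)"
      then have "pseudocongruence Kl P" by (simp add: ex_completion_def)
      then obtain A a q where "presents P A a q" using presentation_of_pseudocongruence by blast
      then have "(P, (A, a), q) \<in> ?E" by simp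
      then show "P \<in> fst ` ?E" by (rule rev_image_eqI) simp
    qed (auto simp: ex_completion_def dest: presents_pseudocongruence)
  next
    fix i j assume "i \<in> ?E" "j \<in> ?E"
    then obtain P A a q P' A' a' q' where ij: "i = (P, (A, a), q)" "j = (P', (A', a'), q')"
      and pr: "presents P A a q" "presents P' A' a' q'" by auto
    show "hom (ex_completion Kl) (fst i) (fst j)
      = map_prod (lifts (fst i) (snd (snd i)) (fst j) (snd (snd j)))
          (lifts (fst i) (snd (snd i)) (fst j) (snd (snd j))) `
        hom (EM_category (Pos small) M) (fst (snd i)) (fst (snd j))"
      using ex_hom_eq[OF pr] by (simp add: ij)
    show "inj_on (lifts (fst i) (snd (snd i)) (fst j) (snd (snd j)))
        (arr (EM_category (Pos small) M) (fst (snd i)) (fst (snd j)))"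
    proof (rule inj_onI)
      fix f g assume "f \<in> arr (EM_category (Pos small) M) (fst (snd i)) (fst (snd j))"
        "g \<in> arr (EM_category (Pos small) M) (fst (snd i)) (fst (snd j))"
        and eq: "lifts (fst i) (snd (snd i)) (fst j) (snd (snd j)) f
          = lifts (fst i) (snd (snd i)) (fst j) (snd (snd j)) g"
      then have fg: "alg_hom A a A' a' f" "alg_hom A a A' a' g"
        using presentsD(7)[OF pr(1)] presentsD(7)[OF pr(2)] by (auto simp: ij EM_arr)
      then show "f = g"
        using lifts_nonempty[OF pr fg(1)] lifts_inj[OF pr fg] eq ij by (metis fst_conv snd_conv)
    qed
  next
    fix i assume "i \<in> ?E"
    then show "lifts (fst i) (snd (snd i)) (fst i) (snd (snd i))
        (idn (EM_category (Pos small) M) (fst (snd i))) = idn (ex_completion Kl) (fst i)"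
      using ex_idn by (auto simp: EM_idn)
  next
    fix i j k f g assume "i \<in> ?E" "j \<in> ?E" "k \<in> ?E"
      and "f \<in> arr (EM_category (Pos small) M) (fst (snd i)) (fst (snd j))"
        "g \<in> arr (EM_category (Pos small) M) (fst (snd j)) (fst (snd k))"
    then show "lifts (fst i) (snd (snd i)) (fst k) (snd (snd k))
        (cmp (EM_category (Pos small) M) (fst (snd i)) (fst (snd j)) (fst (snd k)) g f)
      = cmp (ex_completion Kl) (fst i) (fst j) (fst k)
          (lifts (fst j) (snd (snd j)) (fst k) (snd (snd k)) g)
          (lifts (fst i) (snd (snd i)) (fst j) (snd (snd j)) f)"
      using ex_cmp presentsD(7) by (fastforce simp: EM_cmp EM_arr)
  qed
  then show ?thesis by (rule pos_span.pos_equivalent)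
qed

end

theorem corollary5p2:
  fixes small :: "'a set \<Rightarrow> bool"
    and M :: "('a rel, 'a \<Rightarrow> 'a) pmonad"
  assumes "smallness small"
    and "pos_monad (Pos small) M"
    and "preserves_congruence_coinserters small M"
  shows "pos_equivalent (EM_category (Pos small) M) (ex_completion (kleisli_d small M))"
  using assms
  by (intro pos_monad_congruence.EM_equivalent_ex pos_monad_congruence.intro
      pos_monad_small.intro pos_monad_congruence_axioms.intro)

end
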